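(* Let $p$ be an odd prime, $\Pi$ a $p$-finite profinite group, $A$ a local pro-$p$ domain with field of fractions $K$, $(t,d):\Pi\to A$ a continuous pseudorepresentation, and $\rho:\Pi\to\mathrm{GL}_2(\overline K)$ the semisimple representation carrying $(t,d)$ (i.e. $\operatorname{tr}\rho=t$, $\det\rho=d$). The following are equivalent: (1) $(t,d)$ is a priori small; (2) $\rho$ is reducible, or dihedral, or its constant-determinant twist has finite image; (3) $\rho$ is not strongly irreducible.
   Context: A local pro-$p$ ring is a commutative local topological ring that is an inverse limit of finite rings of $p$-power order, with finite residue field; let $\mathfrak m$, $\mathbb F$ be the maximal ideal and residue field of $A$. $\Pi$ is $p$-finite if for every open subgroup $\Pi_0\subseteq\Pi$ the set of continuous homomorphisms $\Pi_0\to\mathbb F_p$ is finite. A (2-dimensional) pseudorepresentation of a group $G$ over a commutative ring $B$ is a pair of functions $t:G\to B$, $d:G\to B^\times$ with $t(1)=2$, $d(gh)=d(g)d(h)$, $t(gh)=t(hg)$ and $t(gh)+d(h)t(gh^{-1})=t(g)t(h)$. Over an algebraically closed field it is carried by a unique semisimple representation. The kernel of $(t,d)$ is $\ker(t,d)=\{g\in G:d(g)=1,\ t(gx)=t(x)\ \forall x\in G\}$. $(t,d)$ is reducible if $t=\chi_1+\chi_2$ with $\chi_i:G\to B^\times$ characters, otherwise irreducible; it is dihedral if it is irreducible and there is a nontrivial character $\eta:G\to B^\times$ with $(\eta t,\eta^2d)=(t,d)$. A representation $\rho$ over $\overline K$ is called reducible or dihedral in the same sense over $\overline K$. Let $\bar\rho:\Pi\to\mathrm{GL}_2(\mathbb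 F)$ be the semisimple representation carrying $(t,d)\bmod\mathfrak m$. Write $d=s(\bar d)d_1$ with $s$ the Teichmüller lift, $\bar d=d\bmod\mathfrak m$, $d_1:\Pi\to1+\mathfrak m$. The constant-determinant twist of $(t,d)$ (resp. of $\rho$) is its twist by $d_1^{-1/2}$, i.e. $(d_1^{-1/2}t,d_1^{-1}d)$ (resp. $d_1^{-1/2}\otimes\rho$), with square roots taken in $1+\mathfrak m$. $(t,d)$ is a priori small if it is reducible, or dihedral, or the kernel of its constant-determinant twist equals $\ker\bar\rho$. A representation $\rho:G\to\mathrm{GL}_2(F)$ over a field $F$ is strongly irreducible if $\rho|_H$ is irreducible for every finite-index subgroup $H$ of $G$.
   Formalization: In (1), "reducible" and "dihedral" for (t,d) are read over the algebraic closure of K; with characters valued in the units of A the claim fails, e.g. A = Π = Z_p, t(x) = (1+√p)^x + (1−√p)^x, d(x) = (1−p)^x. *)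

theory Defs
  imports
    "HOL-Analysis.Analysis"
    "HOL-Algebra.Coset"
    "HOL-Algebra.Elementary_Groups"
    "HOL-Algebra.Algebraic_Closure_Type"
    "HOL-Computational_Algebra.Fraction_Field"
begin

text \<open>The maximal ideal of a local ring is its set of non-units.\<close>

class local_ring = comm_ring_1 +
  assumes nonunit_add: "\<not> a dvd 1 \<Longrightarrow> \<not> b dvd 1 \<Longrightarrow> \<not> (a + b) dvd 1"

lemma nonunit_mult: "\<not> a dvd 1 \<Longrightarrow> \<not> (a * b) dvd (1 :: 'a::local_ring)"
  by (erule contrapos_nn) (rule dvd_mult_left)

lemma nonunit_minus:
  assumes "\<not> (a - b) dvd (1 :: 'a::local_ring)"
  shows "\<not> (b - a) dvd 1"
proof -
  have "\<not> - (a - b) dvd 1" using assms by (simp only: minus_dvd_iff not_False_eq_True)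
  then show ?thesis by (simp only: minus_diff_eq not_False_eq_True)
qed

lemma nonunit_trans:
  assumes "\<not> (a - b) dvd (1 :: 'a::local_ring)" "\<not> (b - c) dvd 1"
  shows "\<not> (a - c) dvd 1"
proof -
  have "\<not> ((a - b) + (b - c)) dvd 1" using assms by (rule nonunit_add)
  then show ?thesis by (simp only: diff_add_cancel add_diff_eq not_False_eq_True)
qed

lemma nonunit_diff_cong_unit:
  assumes "\<not> (a - b) dvd (1 :: 'a::local_ring)" "a dvd 1"
  shows "b dvd 1"
proof (rule ccontr)
  assume "\<not> b dvd 1"
  with assms(1) have "\<not> ((a - b) + b) dvd 1" by (rule nonunit_add)
  then have "\<not> a dvd 1" by (simp only: diff_add_cancel not_False_eq_True)
  with assms(2) show False by contradiction
qed

lemma unit_some_inverse: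
  assumes "(a :: 'a::comm_ring_1) dvd 1"
  shows "a * (SOME b. a * b = 1) = 1"
proof (rule someI_ex)
  from assms obtain b where "1 = a * b" by (rule dvdE)
  then have "a * b = 1" by (rule sym)
  then show "\<exists>b. a * b = 1" by (rule exI)
qed

definition cong_max :: "'a::local_ring \<Rightarrow> 'a \<Rightarrow> bool" where
  "cong_max a b \<longleftrightarrow> \<not> (a - b) dvd 1"

quotient_type (overloaded) 'a residue_field = "'a::local_ring" / cong_max
  morphisms rep_residue residue
proof (rule equivpI)
  show "reflp (cong_max :: 'a \<Rightarrow> _)"
    by (auto simp: reflp_def cong_max_def)
  show "symp (cong_max :: 'a \<Rightarrow> _)"
    unfolding cong_max_def by (rule sympI) (rule nonunit_minus)
  show "transp (cong_max :: 'a \<Rightarrow> _)"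
    unfolding cong_max_def by (rule transpI) (rule nonunit_trans)
qed

instantiation residue_field :: (local_ring) field
begin

lift_definition zero_residue_field :: "'a residue_field" is 0 .

lift_definition one_residue_field :: "'a residue_field" is 1 .

lift_definition plus_residue_field :: "'a residue_field \<Rightarrow> 'a residue_field \<Rightarrow> 'a residue_field"
  is "(+)"
  unfolding cong_max_def
proof -
  fix a b c d :: 'a
  assume "\<not> (a - b) dvd 1" "\<not> (c - d) dvd 1"
  then have "\<not> ((a - b) + (c - d)) dvd 1"
    by (rule nonunit_add)
  then show "\<not> (a + c - (b + d)) dvd 1"
    by (simp add: algebra_simps)
qed

lift_definition uminus_residue_field :: "'a residue_field \<Rightarrow> 'a residue_field"
  is uminus
  unfolding cong_max_def
proof -
  fix a b :: 'a
  assume "\<not> (a - b) dvd 1"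
  then show "\<not> (- a - - b) dvd 1"
    by (simp add: nonunit_minus)
qed

lift_definition minus_residue_field :: "'a residue_field \<Rightarrow> 'a residue_field \<Rightarrow> 'a residue_field"
  is "(-)"
  unfolding cong_max_def
proof -
  fix a b c d :: 'a
  assume "\<not> (a - b) dvd 1" "\<not> (c - d) dvd 1"
  from nonunit_add[OF this(1) nonunit_minus[OF this(2)]]
  have "\<not> ((a - b) + (d - c)) dvd 1" .
  then show "\<not> (a - c - (b - d)) dvd 1"
    by (simp add: algebra_simps)
qed

lift_definition times_residue_field :: "'a residue_field \<Rightarrow> 'a residue_field \<Rightarrow> 'a residue_field"
  is "(*)"
  unfolding cong_max_def
proof -
  fix a b c d :: 'a
  assume "\<not> (a - b) dvd 1" "\<not> (c - d) dvd 1"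
  from nonunit_add[OF nonunit_mult[OF this(1)] nonunit_mult[OF this(2)]]
  have "\<not> ((a - b) * c + (c - d) * b) dvd 1" .
  then show "\<not> (a * c - b * d) dvd 1"
    by (simp add: algebra_simps)
qed

lift_definition inverse_residue_field :: "'a residue_field \<Rightarrow> 'a residue_field"
  is "\<lambda>a. if a dvd 1 then SOME b. a * b = 1 else 0"
proof -
  fix a b :: 'a
  assume ab: "cong_max a b"
  then have iff: "a dvd 1 \<longleftrightarrow> b dvd 1"
    using nonunit_diff_cong_unit[of a b] nonunit_diff_cong_unit[of b a] nonunit_minus[of a b]
    unfolding cong_max_def by argo
  show "cong_max (if a dvd 1 then SOME c. a * c = 1 else 0)
                 (if b dvd 1 then SOME c. b * c = 1 else 0)"
  proof (cases "a dvd 1")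
    case True
    define a' b' where "a' = (SOME c. a * c = 1)" and "b' = (SOME c. b * c = 1)"
    have 1: "a * a' = 1"
      unfolding a'_def using True by (rule unit_some_inverse)
    have 2: "b * b' = 1"
      unfolding b'_def using True[unfolded iff] by (rule unit_some_inverse)
    have "(b - a) * (a' * b') = (b * b') * a' - (a * a') * b'"
      by (simp only: left_diff_distrib right_diff_distrib mult.assoc mult.commute mult.left_commute)
    also have "\<dots> = a' - b'"
      by (simp only: 1 2 mult_1_left)
    finally have "a' - b' = (b - a) * (a' * b')" ..
    moreover have "\<not> ((b - a) * (a' * b')) dvd 1"
      using ab unfolding cong_max_def by (rule nonunit_mult[OF nonunit_minus])
    ultimately show ?thesis
      using True iff by (simp add: cong_max_def a'_def b'_def)
  qed (simp add: iff[symmetric] cong_max_def)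
qed

definition divide_residue_field :: "'a residue_field \<Rightarrow> 'a residue_field \<Rightarrow> 'a residue_field"
  where "divide_residue_field a b = a * inverse b"

instance
proof
  fix a b c :: "'a residue_field"
  show "a + b + c = a + (b + c)" by transfer (simp add: cong_max_def add.assoc)
  show "a + b = b + a" by transfer (simp add: cong_max_def add.commute)
  show "0 + a = a" by transfer (simp add: cong_max_def)
  show "- a + a = 0" by transfer (simp add: cong_max_def)
  show "a - b = a + - b" by transfer (simp add: cong_max_def)
  show "a * b * c = a * (b * c)" by transfer (simp add: cong_max_def mult.assoc)
  show "a * b = b * a" by transfer (simp add: cong_max_def mult.commute)
  show "1 * a = a" by transfer (simp add: cong_max_def)
  show "(a + b) * c = a * c + b * c" by transfer (simp add: cong_max_def distrib_right)
  show "(0 :: 'a residue_field) \<noteq> 1" by transfer (simp add: cong_max_def)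
  show "inverse a * a = 1" if "a \<noteq> 0"
    using that
  proof transfer
    fix a :: 'a
    assume "\<not> cong_max a 0"
    then have a: "a dvd 1" by (simp add: cong_max_def)
    have "a * (SOME b. a * b = 1) = 1"
      using a by (rule unit_some_inverse)
    then show "cong_max ((if a dvd 1 then SOME b. a * b = 1 else 0) * a) 1"
      using a by (simp add: cong_max_def mult.commute)
  qed
  show "a div b = a * inverse b" by (rule divide_residue_field_def)
  show "inverse (0 :: 'a residue_field) = 0" by transfer (simp add: cong_max_def)
qed

end

definition inverse_system ::
  "'i set \<Rightarrow> ('i \<Rightarrow> 'i \<Rightarrow> bool) \<Rightarrow> ('i \<Rightarrow> 'b ring) \<Rightarrow> ('i \<Rightarrow> 'i \<Rightarrow> 'b \<Rightarrow> 'b) \<Rightarrow> bool"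
where
  "inverse_system I pre R \<phi> \<longleftrightarrow>
     I \<noteq> {} \<and>
     (\<forall>i\<in>I. pre i i) \<and>
     (\<forall>i\<in>I. \<forall>j\<in>I. \<forall>k\<in>I. pre i j \<longrightarrow> pre j k \<longrightarrow> pre i k) \<and>
     (\<forall>i\<in>I. \<forall>j\<in>I. \<exists>k\<in>I. pre i k \<and> pre j k) \<and>
     (\<forall>i\<in>I. ring (R i)) \<and>
     (\<forall>i\<in>I. \<forall>j\<in>I. pre i j \<longrightarrow> \<phi> i j \<in> ring_hom (R j) (R i)) \<and>
     (\<forall>i\<in>I. \<forall>x\<in>carrier (R i). \<phi> i i x = x) \<and>
     (\<forall>i\<in>I. \<forall>j\<in>I. \<forall>k\<in>I. pre i j \<longrightarrow> pre j k \<longrightarrow>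
        (\<forall>x\<in>carrier (R k). \<phi> i j (\<phi> j k x) = \<phi> i k x))"

definition inverse_limit ::
  "'i set \<Rightarrow> ('i \<Rightarrow> 'i \<Rightarrow> bool) \<Rightarrow> ('i \<Rightarrow> 'b ring) \<Rightarrow> ('i \<Rightarrow> 'i \<Rightarrow> 'b \<Rightarrow> 'b) \<Rightarrow> ('i \<Rightarrow> 'b) set"
where
  "inverse_limit I pre R \<phi> =
     {x \<in> (\<Pi>\<^sub>E i\<in>I. carrier (R i)). \<forall>i\<in>I. \<forall>j\<in>I. pre i j \<longrightarrow> \<phi> i j (x j) = x i}"

definition inverse_limit_topology ::
  "'i set \<Rightarrow> ('i \<Rightarrow> 'i \<Rightarrow> bool) \<Rightarrow> ('i \<Rightarrow> 'b ring) \<Rightarrow> ('i \<Rightarrow> 'i \<Rightarrow> 'b \<Rightarrow> 'b) \<Rightarrow> ('i \<Rightarrow> 'b) topology"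
where
  "inverse_limit_topology I pre R \<phi> =
     subtopology (product_topology (\<lambda>i. discrete_topology (carrier (R i))) I)
       (inverse_limit I pre R \<phi>)"

text \<open>
  Fixing the types of the indices and of the finite rings loses nothing: a finite ring has a copy
  with carrier in \<^typ>\<open>nat\<close>, and a system with limit \<open>A\<close> may be replaced by the
  system of the quotients of \<open>A\<close> by the kernels of its projections, indexed by these kernels.
\<close>

definition local_pro_p_ring ::
  "'a::{local_ring, topological_ab_group_add, topological_comm_monoid_mult} itself \<Rightarrow> nat \<Rightarrow> bool"
where
  "local_pro_p_ring _ p \<longleftrightarrow>
     (\<exists>(I :: 'a set set) pre (R :: 'a set \<Rightarrow> nat ring) \<phi> h.
        inverse_system I pre R \<phi> \<and>
        (\<forall>i\<in>I. finite (carrier (R i)) \<and> (\<exists>n. card (carrier (R i)) = p ^ n)) \<and>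
        homeomorphic_map (euclidean :: 'a topology) (inverse_limit_topology I pre R \<phi>) h \<and>
        (\<forall>i\<in>I. (\<lambda>a. h a i) \<in> ring_hom ring_of_type_algebra (R i))) \<and>
     finite (UNIV :: 'a residue_field set)"

definition topological_group :: "('g, 'e) monoid_scheme \<Rightarrow> 'g topology \<Rightarrow> bool" where
  "topological_group G T \<longleftrightarrow>
     group G \<and> topspace T = carrier G \<and>
     continuous_map (prod_topology T T) T (\<lambda>(x, y). x \<otimes>\<^bsub>G\<^esub> y) \<and>
     continuous_map T T (\<lambda>x. inv\<^bsub>G\<^esub> x)"

definition profinite_group :: "('g, 'e) monoid_scheme \<Rightarrow> 'g topology \<Rightarrow> bool" where
  "profinite_group G T \<longleftrightarrow>
     topological_group G T \<and> compact_space T \<and> Hausdorff_space T \<and>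
     (\<forall>S. connectedin T S \<longrightarrow> (\<exists>x. S \<subseteq> {x}))"

text \<open>
  Homomorphisms are taken extensional (\<^const>\<open>undefined\<close> outside the subgroup), so that two of
  them are equal as soon as they agree on the subgroup.
\<close>

definition p_finite :: "nat \<Rightarrow> ('g, 'e) monoid_scheme \<Rightarrow> 'g topology \<Rightarrow> bool" where
  "p_finite p G T \<longleftrightarrow>
     (\<forall>H. subgroup H G \<and> openin T H \<longrightarrow>
        finite {f \<in> hom (G\<lparr>carrier := H\<rparr>) (integer_mod_group p) \<inter> extensional H.
          continuous_map (subtopology T H) (discrete_topology (carrier (integer_mod_group p))) f})"

abbreviation unit_group :: "'b::comm_ring_1 monoid" where
  "unit_group \<equiv> units_of ring_of_type_algebra"

definition pseudorep :: "('g, 'e) monoid_scheme \<Rightarrow> ('g \<Rightarrow> 'b::comm_ring_1) \<Rightarrow> ('g \<Rightarrow> 'b) \<Rightarrow> bool" where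
  "pseudorep G t d \<longleftrightarrow>
     d \<in> hom G unit_group \<and>
     t \<one>\<^bsub>G\<^esub> = 2 \<and>
     (\<forall>g\<in>carrier G. \<forall>h\<in>carrier G. t (g \<otimes>\<^bsub>G\<^esub> h) = t (h \<otimes>\<^bsub>G\<^esub> g)) \<and>
     (\<forall>g\<in>carrier G. \<forall>h\<in>carrier G.
        t (g \<otimes>\<^bsub>G\<^esub> h) + d h * t (g \<otimes>\<^bsub>G\<^esub> inv\<^bsub>G\<^esub> h) = t g * t h)"

definition pseudo_kernel ::
  "('g, 'e) monoid_scheme \<Rightarrow> ('g \<Rightarrow> 'b::comm_ring_1) \<Rightarrow> ('g \<Rightarrow> 'b) \<Rightarrow> 'g set" where
  "pseudo_kernel G t d =
     {g \<in> carrier G. d g = 1 \<and> (\<forall>x\<in>carrier G. t (g \<otimes>\<^bsub>G\<^esub> x) = t x)}"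

definition pseudo_reducible :: "('g, 'e) monoid_scheme \<Rightarrow> ('g \<Rightarrow> 'b::comm_ring_1) \<Rightarrow> bool" where
  "pseudo_reducible G t \<longleftrightarrow>
     (\<exists>\<chi>1\<in>hom G unit_group. \<exists>\<chi>2\<in>hom G unit_group. \<forall>g\<in>carrier G. t g = \<chi>1 g + \<chi>2 g)"

definition pseudo_dihedral ::
  "('g, 'e) monoid_scheme \<Rightarrow> ('g \<Rightarrow> 'b::comm_ring_1) \<Rightarrow> ('g \<Rightarrow> 'b) \<Rightarrow> bool" where
  "pseudo_dihedral G t d \<longleftrightarrow>
     \<not> pseudo_reducible G t \<and>
     (\<exists>\<eta>\<in>hom G unit_group.
        (\<exists>g\<in>carrier G. \<eta> g \<noteq> 1) \<and>
        (\<forall>g\<in>carrier G. \<eta> g * t g = t g \<and> (\<eta> g)\<^sup>2 * d g = d g))"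

definition GL :: "('k::field ^ 'n ^ 'n) monoid" where
  "GL = \<lparr>carrier = {M. invertible M}, mult = (**), one = mat 1\<rparr>"

definition invariant_subspace ::
  "('g, 'e) monoid_scheme \<Rightarrow> ('g \<Rightarrow> 'k::field ^ 'n ^ 'n) \<Rightarrow> ('k ^ 'n) set \<Rightarrow> bool" where
  "invariant_subspace G \<rho> W \<longleftrightarrow> vec.subspace W \<and> (\<forall>g\<in>carrier G. \<forall>v\<in>W. \<rho> g *v v \<in> W)"

definition irreducible_rep :: "('g, 'e) monoid_scheme \<Rightarrow> ('g \<Rightarrow> 'k::field ^ 'n ^ 'n) \<Rightarrow> bool" where
  "irreducible_rep G \<rho> \<longleftrightarrow> (\<forall>W. invariant_subspace G \<rho> W \<longrightarrow> W = {0} \<or> W = UNIV)"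

definition semisimple_rep :: "('g, 'e) monoid_scheme \<Rightarrow> ('g \<Rightarrow> 'k::field ^ 'n ^ 'n) \<Rightarrow> bool" where
  "semisimple_rep G \<rho> \<longleftrightarrow>
     (\<forall>W. invariant_subspace G \<rho> W \<longrightarrow>
        (\<exists>W'. invariant_subspace G \<rho> W' \<and> W \<inter> W' = {0} \<and> (\<forall>v. \<exists>w\<in>W. \<exists>w'\<in>W'. v = w + w')))"

definition strongly_irreducible ::
  "('g, 'e) monoid_scheme \<Rightarrow> ('g \<Rightarrow> 'k::field ^ 2 ^ 2) \<Rightarrow> bool" where
  "strongly_irreducible G \<rho> \<longleftrightarrow>
     (\<forall>H. subgroup H G \<and> finite (rcosets\<^bsub>G\<^esub> H) \<longrightarrow> irreducible_rep (G\<lparr>carrier := H\<rparr>) \<rho>)"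

definition carries ::
  "('g, 'e) monoid_scheme \<Rightarrow> ('g \<Rightarrow> 'k::field ^ 2 ^ 2) \<Rightarrow> ('g \<Rightarrow> 'k) \<Rightarrow> ('g \<Rightarrow> 'k) \<Rightarrow> bool" where
  "carries G \<rho> t d \<longleftrightarrow> (\<forall>g\<in>carrier G. trace (\<rho> g) = t g \<and> det (\<rho> g) = d g)"

definition semisimple_carrier ::
  "('g, 'e) monoid_scheme \<Rightarrow> ('g \<Rightarrow> 'k::field ^ 2 ^ 2) \<Rightarrow> ('g \<Rightarrow> 'k) \<Rightarrow> ('g \<Rightarrow> 'k) \<Rightarrow> bool" where
  "semisimple_carrier G \<rho> t d \<longleftrightarrow> \<rho> \<in> hom G GL \<and> semisimple_rep G \<rho> \<and> carries G \<rho> t d"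

definition reducible_rep :: "('g, 'e) monoid_scheme \<Rightarrow> ('g \<Rightarrow> 'k::field ^ 2 ^ 2) \<Rightarrow> bool" where
  "reducible_rep G \<rho> \<longleftrightarrow> pseudo_reducible G (\<lambda>g. trace (\<rho> g))"

definition dihedral_rep :: "('g, 'e) monoid_scheme \<Rightarrow> ('g \<Rightarrow> 'k::field ^ 2 ^ 2) \<Rightarrow> bool" where
  "dihedral_rep G \<rho> \<longleftrightarrow> pseudo_dihedral G (\<lambda>g. trace (\<rho> g)) (\<lambda>g. det (\<rho> g))"

text \<open>
  A multiplicative section of the residue map takes values among the roots of \<open>X ^ q - X\<close>,
  where \<open>q\<close> is the order of the residue field, and over a complete ring there is exactly one
  such root above each residue class.
\<close>

definition teichmuller :: "'a::local_ring residue_field \<Rightarrow> 'a" where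
  "teichmuller x = (THE a. residue a = x \<and> a ^ CARD('a residue_field) = a)"

definition one_unit_part :: "('g \<Rightarrow> 'a::local_ring) \<Rightarrow> 'g \<Rightarrow> 'a" where
  "one_unit_part d g = d g * inv\<^bsub>ring_of_type_algebra\<^esub> (teichmuller (residue (d g)))"

text \<open>One-units are the elements of \<open>1 + m\<close>, with \<open>m\<close> the maximal ideal.\<close>

definition inv_sqrt :: "'a::local_ring \<Rightarrow> 'a" where
  "inv_sqrt u = (THE c. residue c = 1 \<and> c\<^sup>2 * u = 1)"

definition twist_t :: "('g \<Rightarrow> 'a::local_ring) \<Rightarrow> ('g \<Rightarrow> 'a) \<Rightarrow> 'g \<Rightarrow> 'a" where
  "twist_t t d g = inv_sqrt (one_unit_part d g) * t g"

definition twist_d :: "('g \<Rightarrow> 'a::local_ring) \<Rightarrow> 'g \<Rightarrow> 'a" where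
  "twist_d d g = inv\<^bsub>ring_of_type_algebra\<^esub> (one_unit_part d g) * d g"

definition to_Kbar :: "'a::idom \<Rightarrow> 'a fract alg_closure" where
  "to_Kbar a = to_ac (Fract a 1)"

definition twist_rep ::
  "('g \<Rightarrow> 'a::{local_ring, idom}) \<Rightarrow> ('g \<Rightarrow> 'a fract alg_closure ^ 2 ^ 2)
    \<Rightarrow> 'g \<Rightarrow> 'a fract alg_closure ^ 2 ^ 2" where
  "twist_rep d \<rho> g = mat (to_Kbar (inv_sqrt (one_unit_part d g))) ** \<rho> g"

text \<open>
  Here \<open>\<rho>0\<close> is the residual representation. Reducible and dihedral are understood geometrically,
  with \<open>(t, d)\<close> viewed as a pseudorepresentation over the algebraic closure of the field of
  fractions. Requiring instead characters with values in the units of \<open>A\<close> itself would lose the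
  sum of the characters \<open>x \<mapsto> (1 \<plusminus> sqrt p) ^ x\<close> of the \<open>p\<close>-adic integers: it takes values
  in the \<open>p\<close>-adic integers and is carried by a diagonal representation, but its constituents
  are not defined over them.
\<close>

definition a_priori_small ::
  "('g, 'e) monoid_scheme \<Rightarrow> ('g \<Rightarrow> 'a::{local_ring, idom}) \<Rightarrow> ('g \<Rightarrow> 'a)
    \<Rightarrow> ('g \<Rightarrow> 'a residue_field ^ 2 ^ 2) \<Rightarrow> bool" where
  "a_priori_small G t d \<rho>0 \<longleftrightarrow>
     pseudo_reducible G (to_Kbar \<circ> t) \<or>
     pseudo_dihedral G (to_Kbar \<circ> t) (to_Kbar \<circ> d) \<or>
     pseudo_kernel G (twist_t t d) (twist_d d) = kernel G GL \<rho>0"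

end

theory Submission
  imports
    Defs
    "HOL-Algebra.Sylow"
    "HOL-Algebra.Group_Action"
    "HOL-Number_Theory.Residues"
begin

text \<open>
  Let \<open>\<sigma>\<close> be the constant-determinant twist of \<open>\<rho>\<close>. Twisting by scalars changes
  neither reducibility nor dihedrality nor strong irreducibility, and \<open>det \<sigma>\<close> takes its values among
  the Teichmueller representatives, hence only finitely many values. The theorem is a statement about
  \<open>\<sigma>\<close>, and almost all of it is the geometry of lines in a plane: a representation of dimension two
  is reducible exactly if it stabilises a line, also when reducibility is understood through the trace
  (\<open>reducible_rep_iff\<close>).

  \<^emph>\<open>Failure of strong irreducibility.\<close> Suppose that a subgroup of finite index stabilises a line.
  Then the orbit of that line under the whole group is finite. If the orbit has one element, \<open>\<sigma>\<close> is
  reducible; if it has two, the group permutes two lines, all elements that swap them have trace zero, and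
  \<open>\<sigma>\<close> is reducible or dihedral (\<open>imprimitive_imp_reducible_or_dihedral\<close>). If it has at
  least three, an element that fixes three of them is a scalar, and there are only finitely many scalars with a square
  among the values of \<open>det \<sigma>\<close>; so \<open>\<sigma>\<close> has finite image
  (\<open>finite_index_stable_line\<close>). Conversely, a finite image has a kernel of finite index, and a dihedral
  representation becomes commutative on the kernel of its quadratic character
  (\<open>dihedral_imp_finite_index_stable_line\<close>).

  \<^emph>\<open>A priori smallness.\<close> A semisimple representation of dimension two over any field has the same
  kernel as its pseudorepresentation (\<open>semisimple_kernel\<close>). So the condition on kernels in a priori
  smallness says that \<open>\<sigma>\<close> and the residual representation have equal kernels. The latter has finite
  image, which gives one direction. For the other, let \<open>\<sigma>\<close> have finite image. The kernel of
  \<open>\<sigma>\<close> lies in the residual kernel \<open>N\<close>, because the twist is trivial modulo the maximal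
  ideal. On \<open>N\<close> the determinant of \<open>\<sigma>\<close> is 1 and its trace is congruent to 2, which
  excludes nontrivial elements of order prime to \<open>p\<close> (\<open>one_if_power_one\<close>). So
  \<open>\<sigma>(N)\<close> is a finite \<open>p\<close>-group, normal in the image. If it is not trivial, it has a
  central element \<open>z \<noteq> 1\<close>, which is not a scalar since \<open>p\<close> is odd. All conjugates of
  \<open>z\<close> commute with \<open>z\<close>, so the whole orbit of an eigenline of \<open>z\<close> consists of
  eigenlines of \<open>z\<close>. There are at most two of these, and \<open>\<sigma>\<close> is reducible or dihedral
  (\<open>normal_p_subgroup_trivial\<close>).

  The scalars of the twist are defined through the Teichmueller lift and square roots of one-units. Both exist uniquely
  by a form of Hensel's lemma (\<open>hensel\<close>), which follows from compactness, and uniqueness makes them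
  multiplicative.
\<close>

(* Without this, a component of a vector could also be read as a coefficient of a power series. *)
no_notation fps_nth (infixl \<open>$\<close> 75)

section \<open>Hensel's lemma in a local pro-p ring\<close>

lemma residue_eq_iff: "residue a = residue b \<longleftrightarrow> \<not> (a - b) dvd 1"
  using residue_field.abs_eq_iff[of a b] by (simp add: cong_max_def)

lemma residue_0: "residue 0 = 0" and residue_1: "residue 1 = 1"
  by (simp_all add: zero_residue_field_def one_residue_field_def)

lemma residue_add: "residue (a + b) = residue a + residue b"
  and residue_mult: "residue (a * b) = residue a * residue b"
  and residue_diff: "residue (a - b) = residue a - residue b"
  by (simp_all add: plus_residue_field.abs_eq times_residue_field.abs_eq minus_residue_field.abs_eq)

lemma residue_eq_0_iff: "residue a = 0 \<longleftrightarrow> \<not> a dvd 1"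
  using residue_eq_iff[of a 0] by (simp add: residue_0)

lemma residue_power: "residue (a ^ n) = residue a ^ n"
  by (induction n) (simp_all add: residue_1 residue_mult)

lemma residue_of_nat: "residue (of_nat n) = of_nat n"
  by (induction n) (simp_all add: residue_0 residue_1 residue_add)

lemma residue_sum: "residue (\<Sum>i\<in>S. f i) = (\<Sum>i\<in>S. residue (f i))"
  by (induction S rule: infinite_finite_induct) (simp_all add: residue_0 residue_add)

lemmas residue_simps = residue_0 residue_1 residue_add residue_mult residue_diff residue_power
  residue_of_nat residue_sum

lemma residue_surj: "\<exists>a. residue a = x"
  by (metis Quotient3_abs_rep Quotient3_residue_field)

lemma ring_of_type_algebra_simps:
  "carrier ring_of_type_algebra = UNIV" "x \<otimes>\<^bsub>ring_of_type_algebra\<^esub> y = x * y"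
  "x \<oplus>\<^bsub>ring_of_type_algebra\<^esub> y = x + y" "\<one>\<^bsub>ring_of_type_algebra\<^esub> = 1" "\<zero>\<^bsub>ring_of_type_algebra\<^esub> = 0"
  by (simp_all add: ring_of_type_algebra_def)

lemma unit_group_simps:
  "carrier (unit_group :: 'b::comm_ring_1 monoid) = {x. x dvd 1}"
  "x \<otimes>\<^bsub>unit_group\<^esub> y = x * y" "\<one>\<^bsub>unit_group\<^esub> = (1 :: 'b)"
  by (auto simp: units_of_def Units_def ring_of_type_algebra_simps dvd_def mult.commute intro: sym)

lemma hom_unit_group_iff:
  "\<alpha> \<in> hom G unit_group \<longleftrightarrow>
     (\<forall>g\<in>carrier G. \<alpha> g dvd 1) \<and> (\<forall>g\<in>carrier G. \<forall>h\<in>carrier G. \<alpha> (g \<otimes>\<^bsub>G\<^esub> h) = \<alpha> g * \<alpha> h)"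
  by (auto simp: hom_def Pi_def unit_group_simps)

lemma unit_inverse:
  fixes a :: "'a::comm_ring_1"
  assumes "a dvd 1"
  shows "a * inv\<^bsub>ring_of_type_algebra\<^esub> a = 1"
proof -
  interpret R: cring "ring_of_type_algebra :: 'a ring" ..
  have "a \<in> Units ring_of_type_algebra"
    using assms unit_group_simps(1) by (auto simp: units_of_def)
  then show ?thesis using R.Units_r_inv by (simp add: ring_of_type_algebra_simps)
qed

lemma unit_cancel:
  fixes a b c :: "'a::comm_ring_1"
  assumes "c dvd 1" "a * c = b * c"
  shows "a = b"
  using assms by (metis dvdE mult.assoc mult.right_neutral)

text \<open>
  What Hensel's lemma needs of a presentation as an inverse limit: each projection \<open>\<lambda>a. h a i\<close> is
  the quotient by an ideal of finite index with closed cosets, these ideals form a directed system with intersection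
  zero, and the ring is compact. Finite quotients are thus handled through \<open>h\<close> alone, without carriers and
  operations of their own.
\<close>

locale pro_p_presentation =
  fixes p :: nat and I :: "'i set" and h :: "'a::{local_ring, topological_space} \<Rightarrow> 'i \<Rightarrow> 'b"
  assumes directed: "\<And>i j. i \<in> I \<Longrightarrow> j \<in> I \<Longrightarrow>
      \<exists>k\<in>I. \<forall>a b. h a k = h b k \<longrightarrow> h a i = h b i \<and> h a j = h b j"
    and nonempty: "I \<noteq> {}"
    and finite_range: "\<And>i. i \<in> I \<Longrightarrow> finite (range (\<lambda>a. h a i))"
    and fibre_closed: "\<And>i S. i \<in> I \<Longrightarrow> closed {a. h a i \<in> S}"
    and compact_UNIV: "compact (UNIV :: 'a set)"
    and separated: "\<And>a b. (\<And>i. i \<in> I \<Longrightarrow> h a i = h b i) \<Longrightarrow> a = b"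
    and eq_iff_diff: "\<And>i a b. i \<in> I \<Longrightarrow> h a i = h b i \<longleftrightarrow> h (a - b) i = h 0 i"
    and zero_mult: "\<And>i a b. i \<in> I \<Longrightarrow> h a i = h 0 i \<Longrightarrow> h (a * b) i = h 0 i"
    and p_power_zero: "\<And>i. i \<in> I \<Longrightarrow> \<exists>n. h (of_nat p ^ n) i = h 0 i"

text \<open>
  The inverse limit is closed in a product of finite discrete spaces, so compact. A power of \<open>p\<close> vanishes
  in each finite ring because the order of its additive group is such a power.
\<close>

lemma local_pro_p_ring_presentation:
  assumes "local_pro_p_ring TYPE('a::{local_ring, topological_ab_group_add, topological_comm_monoid_mult}) p"
  shows "\<exists>I (h :: 'a \<Rightarrow> 'a set \<Rightarrow> nat). pro_p_presentation p I h"
proof -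
  from assms obtain I :: "'a set set" and pre and R :: "'a set \<Rightarrow> nat ring" and \<phi> h
    where sys: "inverse_system I pre R \<phi>"
      and fin: "\<And>i. i \<in> I \<Longrightarrow> finite (carrier (R i))"
      and card: "\<And>i. i \<in> I \<Longrightarrow> \<exists>n. card (carrier (R i)) = p ^ n"
      and homeo: "homeomorphic_map (euclidean :: 'a topology) (inverse_limit_topology I pre R \<phi>) h"
      and hom: "\<And>i. i \<in> I \<Longrightarrow> (\<lambda>a. h a i) \<in> ring_hom ring_of_type_algebra (R i)"
    unfolding local_pro_p_ring_def by metis
  define Q where "Q = product_topology (\<lambda>i. discrete_topology (carrier (R i))) I"
  have limit_top: "inverse_limit_topology I pre R \<phi> = subtopology Q (inverse_limit I pre R \<phi>)"
    by (simp add: inverse_limit_topology_def Q_def)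
  have limit_sub: "inverse_limit I pre R \<phi> \<subseteq> topspace Q"
    by (auto simp: inverse_limit_def Q_def)
  have proj: "continuous_map Q (discrete_topology (carrier (R i))) (\<lambda>x. x i)" if "i \<in> I" for i
    unfolding Q_def using that by (rule continuous_map_product_projection)
  have cont: "continuous_map euclidean Q h"
    using homeomorphic_imp_continuous_map[OF homeo] unfolding limit_top
    by (rule continuous_map_into_fulltopology)
  have h_in: "h a \<in> inverse_limit I pre R \<phi>" for a
    using homeomorphic_imp_surjective_map[OF homeo] limit_sub
    by (auto simp: limit_top topspace_subtopology)
  have ring: "ring (R i)" if "i \<in> I" for i
    using sys that by (auto simp: inverse_system_def)
  have h_car: "h a i \<in> carrier (R i)" if "i \<in> I" for a i
    using hom[OF that] by (auto simp: ring_hom_def ring_of_type_algebra_simps)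
  have compat: "\<phi> i j (h a j) = h a i" if "i \<in> I" "j \<in> I" "pre i j" for i j a
    using h_in[of a] that by (auto simp: inverse_limit_def)
  have h_add: "h (a + b) i = h a i \<oplus>\<^bsub>R i\<^esub> h b i" if "i \<in> I" for i a b
    using hom[OF that] by (auto simp: ring_hom_def ring_of_type_algebra_simps)
  have h_mult: "h (a * b) i = h a i \<otimes>\<^bsub>R i\<^esub> h b i" if "i \<in> I" for i a b
    using hom[OF that] by (auto simp: ring_hom_def ring_of_type_algebra_simps)
  have h_zero: "h 0 i = \<zero>\<^bsub>R i\<^esub>" if "i \<in> I" for i
  proof -
    interpret ring "R i" by (rule ring[OF that])
    have "h 0 i \<oplus>\<^bsub>R i\<^esub> h 0 i = h 0 i" using h_add[OF that, of 0 0] by simp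
    then show ?thesis using h_car[OF that, of 0] by (metis add.r_cancel_one)
  qed
  have closed_limit: "closedin Q (inverse_limit I pre R \<phi>)"
  proof -
    define E where "E i j = {x \<in> topspace Q. \<phi> i j (x j) = x i}" for i j
    have cl: "closedin Q (E i j)" if "i \<in> I" "j \<in> I" for i j
    proof -
      have "closedin Q {x \<in> topspace Q. (x i, x j) \<in> {(a, b). a \<in> carrier (R i) \<and> b \<in> carrier (R j) \<and> \<phi> i j b = a}}"
      proof (rule closedin_continuous_map_preimage)
        show "continuous_map Q (prod_topology (discrete_topology (carrier (R i))) (discrete_topology (carrier (R j)))) (\<lambda>x. (x i, x j))"
          using that by (intro continuous_map_pairedI proj)
        show "closedin (prod_topology (discrete_topology (carrier (R i))) (discrete_topology (carrier (R j))))
            {(a, b). a \<in> carrier (R i) \<and> b \<in> carrier (R j) \<and> \<phi> i j b = a}"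
          by (auto simp: prod_topology_discrete_topology[symmetric])
      qed
      moreover have "x k \<in> carrier (R k)" if "x \<in> topspace Q" "k \<in> I" for x k
        using that by (auto simp: Q_def PiE_def)
      then have "{x \<in> topspace Q. (x i, x j) \<in> {(a, b). a \<in> carrier (R i) \<and> b \<in> carrier (R j) \<and> \<phi> i j b = a}} = E i j"
        using that by (auto simp: E_def)
      ultimately show ?thesis by simp
    qed
    define K where "K = {E i j | i j. i \<in> I \<and> j \<in> I \<and> pre i j}"
    have "inverse_limit I pre R \<phi> = topspace Q \<inter> \<Inter> K"
      by (auto simp: inverse_limit_def Q_def E_def K_def)
    also have "closedin Q \<dots>"
    proof (cases "K = {}")
      case False
      then have "closedin Q (\<Inter> K)"
        by (rule closedin_Inter) (use cl in \<open>auto simp: K_def\<close>)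
      then show ?thesis by blast
    qed simp
    finally show ?thesis .
  qed
  have "compact_space Q"
    unfolding Q_def compact_space_product_topology using fin
    by (auto simp: compact_space_discrete_topology)
  then have "compact_space (inverse_limit_topology I pre R \<phi>)"
    unfolding limit_top by (intro compact_space_subtopology closedin_compact_space closed_limit)
  then have "compact_space (euclidean :: 'a topology)"
    using homeomorphic_compact_space homeomorphic_map_imp_homeomorphic_space[OF homeo] by blast
  then have comp: "compact (UNIV :: 'a set)" by (simp add: compact_space_def)
  have "pro_p_presentation p I h"
  proof
    fix i j assume ij: "i \<in> I" "j \<in> I"
    then obtain k where "k \<in> I" "pre i k" "pre j k" using sys unfolding inverse_system_def by metis
    then show "\<exists>k\<in>I. \<forall>a b. h a k = h b k \<longrightarrow> h a i = h b i \<and> h a j = h b j"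
      using compat ij by metis
  next
    show "I \<noteq> {}" using sys by (simp add: inverse_system_def)
  next
    fix i assume i: "i \<in> I"
    show "finite (range (\<lambda>a. h a i))"
      by (rule finite_subset[OF _ fin[OF i]]) (use h_car[OF i] in auto)
    show "closed {a. h a i \<in> S}" for S
    proof -
      have "closedin euclidean {a \<in> topspace euclidean. h a i \<in> S \<inter> carrier (R i)}"
        by (rule closedin_continuous_map_preimage[OF continuous_map_compose[OF cont proj[OF i], unfolded o_def]]) simp
      moreover have "{a \<in> topspace euclidean. h a i \<in> S \<inter> carrier (R i)} = {a. h a i \<in> S}"
        using h_car[OF i] by auto
      ultimately show ?thesis by simp
    qed
    show "h a i = h b i \<longleftrightarrow> h (a - b) i = h 0 i" for a b
    proof -
      interpret ring "R i" by (rule ring[OF i])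
      have "h a i = h (a - b) i \<oplus>\<^bsub>R i\<^esub> h b i" using h_add[OF i, of "a - b" b] by simp
      then show ?thesis using h_car[OF i] h_zero[OF i] by (metis l_zero add.r_cancel_one)
    qed
    show "h (a * b) i = h 0 i" if "h a i = h 0 i" for a b
    proof -
      interpret ring "R i" by (rule ring[OF i])
      show ?thesis using that h_car[OF i] by (simp add: h_mult[OF i] h_zero[OF i])
    qed
    show "\<exists>n. h (of_nat p ^ n) i = h 0 i"
    proof -
      interpret ring "R i" by (rule ring[OF i])
      obtain n where n: "card (carrier (R i)) = p ^ n" using card[OF i] by blast
      have "h (of_nat m) i = h 1 i [^]\<^bsub>add_monoid (R i)\<^esub> m" for m
      proof (induction m)
        case 0
        then show ?case using h_zero[OF i] by simp
      next
        case (Suc m)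
        have "h (of_nat (Suc m)) i = h (of_nat m) i \<oplus>\<^bsub>R i\<^esub> h 1 i"
          using h_add[OF i, of "of_nat m" 1] by (simp add: add.commute)
        with Suc show ?case by simp
      qed
      then have "h (of_nat (p ^ n)) i = h 1 i [^]\<^bsub>add_monoid (R i)\<^esub> (p ^ n)" .
      also have "\<dots> = \<zero>\<^bsub>R i\<^esub>"
        using group.pow_order_eq_1[OF a_group, of "h 1 i"] h_car[OF i] n by (simp add: order_def)
      finally have "h (of_nat (p ^ n)) i = \<zero>\<^bsub>R i\<^esub>" .
      then show ?thesis by (auto simp: h_zero[OF i] intro: exI[of _ n])
    qed
  next
    fix a b assume "\<And>i. i \<in> I \<Longrightarrow> h a i = h b i"
    then have "h a = h b"
      using h_in[of a] h_in[of b] by (auto simp: inverse_limit_def intro: PiE_ext)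
    then show "a = b"
      using homeomorphic_imp_injective_map[OF homeo] by (auto simp: inj_on_def)
  qed (rule comp)
  then show ?thesis by blast
qed

context pro_p_presentation
begin

lemma zero_imp_nonunit:
  assumes i: "i \<in> I" "h 1 i \<noteq> h 0 i" and a: "h a i = h 0 i"
  shows "\<not> a dvd 1"
proof
  assume "a dvd 1"
  then obtain b where "1 = a * b" by (elim dvdE)
  with zero_mult[OF i(1) a, of b] i(2) show False by simp
qed

lemma nontrivial_index: "\<exists>i\<in>I. h 1 i \<noteq> h 0 i"
  using separated[of 1 0] by auto

text \<open>
  Otherwise a power of \<open>p\<close> would be a unit that vanishes in a nonzero finite quotient.
\<close>

lemma p_nonunit: "\<not> (of_nat p :: 'a) dvd 1"
proof
  assume unit: "(of_nat p :: 'a) dvd 1"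
  obtain i where i: "i \<in> I" "h 1 i \<noteq> h 0 i" using nontrivial_index by blast
  obtain n where "h (of_nat p ^ n) i = h 0 i" using p_power_zero[OF i(1)] by blast
  then have "\<not> (of_nat p ^ n :: 'a) dvd 1" by (rule zero_imp_nonunit[OF i])
  moreover have "(of_nat p ^ n :: 'a) dvd 1" using dvd_power_same[OF unit, of n] by simp
  ultimately show False by contradiction
qed

lemma of_nat_unit:
  assumes "coprime n p"
  shows "(of_nat n :: 'a) dvd 1"
proof (rule ccontr)
  assume n: "\<not> (of_nat n :: 'a) dvd 1"
  have "p \<noteq> 1" using p_nonunit by auto
  then have "n \<noteq> 0" using assms by (metis coprime_0_left_iff is_unit_gcd nat_dvd_1_iff_1)
  then obtain x y where "n * x = p * y + 1" using bezout_nat[of n p] assms by auto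
  then have "(of_nat n * of_nat x :: 'a) = of_nat p * of_nat y + 1"
    by (metis of_nat_1 of_nat_add of_nat_mult)
  then have "residue (of_nat n * of_nat x :: 'a) = residue (of_nat p * of_nat y + 1 :: 'a)" by simp
  moreover have "residue (of_nat n :: 'a) = 0" "residue (of_nat p :: 'a) = 0"
    using n p_nonunit by (simp_all add: residue_eq_0_iff)
  ultimately show False by (simp add: residue_add residue_mult residue_1)
qed

lemma directed_finite:
  assumes "finite J" "J \<subseteq> I"
  shows "\<exists>k\<in>I. \<forall>i\<in>J. \<forall>a b. h a k = h b k \<longrightarrow> h a i = h b i"
  using assms
proof (induction J rule: finite_induct)
  case empty
  then show ?case using nonempty by blast
next
  case (insert j J)
  then obtain k where k: "k \<in> I" "\<forall>i\<in>J. \<forall>a b. h a k = h b k \<longrightarrow> h a i = h b i" by blast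
  obtain l where "l \<in> I" "\<forall>a b. h a l = h b l \<longrightarrow> h a j = h b j \<and> h a k = h b k"
    using directed[of j k] k(1) insert.prems by auto
  with k(2) show ?case by (metis insert_iff)
qed

text \<open>
  The hypothesis says that \<open>g\<close> is, up to units, an isometry on a residue class. So modulo each of the
  ideals of the presentation \<open>g\<close> is injective on a finite set, hence bijective up to a translation, and
  \<open>g a = y\<close> has a solution there. These approximate solutions form a directed family of nonempty closed
  sets, and compactness gives a common element.
\<close>

proposition hensel:
  fixes g :: "'a \<Rightarrow> 'a"
  assumes diff: "\<And>a b. residue a = x \<Longrightarrow> residue b = x \<Longrightarrow> \<exists>u. u dvd 1 \<and> g a - g b = (a - b) * u"
    and a0: "residue a0 = x" "residue (g a0) = residue y"
  shows "\<exists>!a. residue a = x \<and> g a = y"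
proof (rule ex_ex1I)
  fix a b assume ab: "residue a = x \<and> g a = y" "residue b = x \<and> g b = y"
  then obtain u where u: "u dvd 1" "g a - g b = (a - b) * u" using diff by metis
  then obtain w where "1 = u * w" by (elim dvdE)
  then have "a - b = (a - b) * (u * w)" by simp
  also have "\<dots> = (g a - g b) * w" by (simp add: u(2) mult.assoc)
  finally show "a = b" using ab by simp
next
  define A where "A = {a. residue a = x}"
  have cong: "h (g a) i = h (g b) i \<longleftrightarrow> h a i = h b i" if "i \<in> I" "a \<in> A" "b \<in> A" for i a b
  proof -
    obtain u where u: "u dvd 1" "g a - g b = (a - b) * u" using diff \<open>a \<in> A\<close> \<open>b \<in> A\<close> unfolding A_def by blast
    then obtain w where "1 = u * w" by (elim dvdE)
    then have "a - b = (g a - g b) * w" by (simp add: u(2) mult.assoc flip: \<open>1 = u * w\<close>)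
    then show ?thesis
      using eq_iff_diff[OF that(1)] zero_mult[OF that(1)] u(2) by metis
  qed
  define C where "C i = {a \<in> A. h (g a) i = h y i}" for i
  have C_nonempty: "C i \<noteq> {}" if i: "i \<in> I" for i
  proof -
    define \<pi> where "\<pi> a = h a i" for a
    \<comment> \<open>Translated so that \<open>g'\<close> maps the residue class of \<open>a0\<close> to itself; the value \<open>a0\<close> of \<open>g'\<close> is wanted.\<close>
    define g' where "g' a = g a - y + a0" for a
    have g'_A: "g' a \<in> A" if "a \<in> A" for a
    proof -
      obtain u where "g a - g a0 = (a - a0) * u" using diff a0(1) \<open>a \<in> A\<close> unfolding A_def by blast
      then have "residue (g a - g a0) = (residue a - residue a0) * residue u"
        by (simp only: residue_diff residue_mult)
      then have "residue (g a) = residue (g a0)"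
        using that a0(1) by (simp add: A_def residue_diff)
      then show ?thesis using a0 by (simp add: A_def g'_def residue_add residue_diff)
    qed
    have g'_inj: "\<pi> (g' a) = \<pi> (g' b) \<longleftrightarrow> \<pi> a = \<pi> b" if "a \<in> A" "b \<in> A" for a b
    proof -
      have "\<pi> (g' a) = \<pi> (g' b) \<longleftrightarrow> \<pi> (g a) = \<pi> (g b)"
        unfolding \<pi>_def using eq_iff_diff[OF i, of "g' a" "g' b"] eq_iff_diff[OF i, of "g a" "g b"]
        by (simp add: g'_def)
      then show ?thesis using cong[OF i that] by (simp add: \<pi>_def)
    qed
    \<comment> \<open>The map induced by \<open>g'\<close> on the finite set of classes, through representatives.\<close>
    define s where "s = inv_into A \<pi>"
    have s: "s e \<in> A" "\<pi> (s e) = e" if "e \<in> \<pi> ` A" for e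
      using that by (auto simp: s_def inv_into_into f_inv_into_f)
    have "finite (\<pi> ` A)"
      using finite_range[OF i] by (rule finite_subset[rotated]) (auto simp: \<pi>_def)
    moreover have "(\<lambda>e. \<pi> (g' (s e))) ` \<pi> ` A \<subseteq> \<pi> ` A" using s g'_A by auto
    moreover have "inj_on (\<lambda>e. \<pi> (g' (s e))) (\<pi> ` A)"
    proof (rule inj_onI)
      fix e e' assume e: "e \<in> \<pi> ` A" "e' \<in> \<pi> ` A" and "\<pi> (g' (s e)) = \<pi> (g' (s e'))"
      then have "\<pi> (s e) = \<pi> (s e')" using g'_inj[OF s(1)[OF e(1)] s(1)[OF e(2)]] by blast
      then show "e = e'" using s(2) e by simp
    qed
    ultimately have "(\<lambda>e. \<pi> (g' (s e))) ` \<pi> ` A = \<pi> ` A" by (rule endo_inj_surj)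
    moreover have "\<pi> a0 \<in> \<pi> ` A" using a0(1) by (simp add: A_def)
    ultimately have "\<pi> a0 \<in> (\<lambda>e. \<pi> (g' (s e))) ` \<pi> ` A" by simp
    then obtain e where e: "e \<in> \<pi> ` A" "\<pi> (g' (s e)) = \<pi> a0" by (metis (no_types, lifting) imageE)
    have "h (g (s e)) i = h y i"
      using e(2) eq_iff_diff[OF i, of "g' (s e)" a0] eq_iff_diff[OF i, of "g (s e)" y]
      by (simp add: \<pi>_def g'_def)
    then show ?thesis using s(1)[OF e(1)] by (auto simp: C_def)
  qed
  have C_closed: "closed (C i)" if i: "i \<in> I" for i
  proof -
    \<comment> \<open>The ideal at \<open>i0\<close> is proper, so the fibres over an index beyond \<open>i0\<close> lie in single residue classes.\<close>
    obtain i0 where i0: "i0 \<in> I" "h 1 i0 \<noteq> h 0 i0" using nontrivial_index by blast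
    obtain k where k: "k \<in> I" "\<forall>a b. h a k = h b k \<longrightarrow> h a i = h b i \<and> h a i0 = h b i0"
      using directed[OF i i0(1)] by blast
    have saturated: "a \<in> C i" if ab: "b \<in> C i" "h a k = h b k" for a b
    proof -
      have "h (a - b) i0 = h 0 i0" using k(2) ab(2) eq_iff_diff[OF i0(1)] by blast
      then have "residue a = residue b"
        unfolding residue_eq_iff by (rule zero_imp_nonunit[OF i0])
      then have "a \<in> A" using ab(1) by (simp add: C_def A_def)
      moreover have "b \<in> A" using ab(1) by (simp add: C_def)
      moreover have "h a i = h b i" using k(2) ab(2) by blast
      ultimately have "h (g a) i = h (g b) i" using cong[OF i] by blast
      moreover note \<open>a \<in> A\<close>
      ultimately show ?thesis using ab(1) by (simp add: C_def)
    qed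
    have "C i = {a. h a k \<in> (\<lambda>a. h a k) ` C i}" by (auto intro: saturated)
    moreover have "closed {a. h a k \<in> (\<lambda>a. h a k) ` C i}" by (rule fibre_closed[OF k(1)])
    ultimately show ?thesis by simp
  qed
  have "UNIV \<inter> (\<Inter>i\<in>I. C i) \<noteq> {}"
  proof (rule compact_imp_fip_image[OF compact_UNIV C_closed])
    fix J assume J: "finite J" "J \<subseteq> I"
    obtain k where k: "k \<in> I" "\<forall>i\<in>J. \<forall>a b. h a k = h b k \<longrightarrow> h a i = h b i"
      using directed_finite[OF J] by blast
    have "a \<in> C i" if "a \<in> C k" "i \<in> J" for a i
    proof -
      have "a \<in> A" "h (g a) k = h y k" using that(1) by (simp_all add: C_def)
      moreover have "h (g a) i = h y i" using k(2) that(2) \<open>h (g a) k = h y k\<close> by blast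
      ultimately show ?thesis by (simp add: C_def)
    qed
    then have "C k \<subseteq> (\<Inter>i\<in>J. C i)" by blast
    with C_nonempty[OF k(1)] show "UNIV \<inter> (\<Inter>i\<in>J. C i) \<noteq> {}" by blast
  qed
  then obtain a where a: "\<And>i. i \<in> I \<Longrightarrow> a \<in> C i" by blast
  then have "g a = y" by (intro separated) (simp add: C_def)
  moreover have "a \<in> A" using a nonempty by (auto simp: C_def)
  ultimately show "\<exists>a. residue a = x \<and> g a = y" by (auto simp: A_def)
qed

text \<open>
  The difference quotient \<open>(a + b) * u\<close> of \<open>\<lambda>c. c\<^sup>2 * u\<close> is congruent to 2 at
  one-units, and 2 is a unit.
\<close>

lemma inv_sqrt_ex1:
  assumes p: "odd p" and u: "residue u = 1"
  shows "\<exists>!c :: 'a. residue c = 1 \<and> c\<^sup>2 * u = 1"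
proof (rule hensel[of _ "\<lambda>c. c\<^sup>2 * u" 1])
  have two: "(2 :: 'a) dvd 1" using of_nat_unit[of 2] p by simp
  show "\<exists>w. w dvd 1 \<and> a\<^sup>2 * u - b\<^sup>2 * u = (a - b) * w" if ab: "residue a = 1" "residue b = 1" for a b
  proof (intro exI conjI)
    have "residue ((a + b) * u) = residue 2"
      using ab u by (simp add: residue_add residue_mult) (metis one_add_one residue_1 residue_add)
    then have "residue ((a + b) * u) \<noteq> 0" using two by (simp add: residue_eq_0_iff)
    then show "(a + b) * u dvd 1" by (simp add: residue_eq_0_iff)
  qed (simp add: power2_eq_square algebra_simps)
qed (simp_all add: residue_1 residue_power residue_mult u)

end

lemma residue_field_power_card:
  fixes x :: "'a::local_ring residue_field"
  assumes fin: "finite (UNIV :: 'a residue_field set)"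
  shows "x ^ CARD('a residue_field) = x"
proof (cases "x = 0")
  case True
  then show ?thesis using fin by (simp add: zero_power finite_UNIV_card_ge_0)
next
  case False
  interpret R: cring "ring_of_type_algebra :: 'a residue_field ring" ..
  interpret M: group "unit_group :: 'a residue_field monoid" by (rule R.units_group)
  have pow: "y [^]\<^bsub>unit_group\<^esub> n = y ^ n" for y :: "'a residue_field" and n :: nat
    by (induction n) (simp_all add: unit_group_simps mult.commute)
  have "carrier (unit_group :: 'a residue_field monoid) = UNIV - {0}"
    by (auto simp: unit_group_simps dvd_field_iff)
  with M.pow_order_eq_1[of x] False
  have "x ^ (CARD('a residue_field) - 1) = 1"
    by (simp add: pow order_def unit_group_simps card_Diff_singleton dvd_field_iff)
  then have "x ^ Suc (CARD('a residue_field) - 1) = x" by simp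
  then show ?thesis using fin finite_UNIV_card_ge_0[OF fin] by simp
qed

text \<open>
  With \<open>q\<close> the order of the residue field, every element of that field is a root of \<open>X ^ q -
  X\<close>, and the derivative there is \<open>-1\<close>, as \<open>q\<close> vanishes in it.
\<close>

lemma (in pro_p_presentation) teichmuller_ex1:
  assumes fin: "finite (UNIV :: 'a residue_field set)"
  shows "\<exists>!a :: 'a. residue a = x \<and> a ^ CARD('a residue_field) = a"
proof -
  define q where "q = CARD('a residue_field)"
  have q0: "(of_nat q :: 'a residue_field) = 0"
    using CHAR_dvd_CARD[where 'a = "'a residue_field"] by (simp add: q_def of_nat_eq_0_iff_char_dvd)
  have "\<exists>!a :: 'a. residue a = x \<and> a ^ q - a = 0"
  proof -
    obtain a0 where a0: "residue a0 = x" using residue_surj by blast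
    show ?thesis
    proof (rule hensel[of _ "\<lambda>a. a ^ q - a" a0])
      show "residue a0 = x" by (rule a0)
      show "residue (a0 ^ q - a0) = residue 0"
        using residue_field_power_card[OF fin, of "residue a0"]
        by (simp add: residue_diff residue_power residue_0 q_def)
      fix a b :: 'a assume ab: "residue a = x" "residue b = x"
      define w where "w = (\<Sum>i<q. b ^ (q - Suc i) * a ^ i) - 1"
      have "residue w = (\<Sum>i<q. x ^ (q - Suc i) * x ^ i) - 1"
        by (simp add: w_def residue_simps ab)
      also have "(\<Sum>i<q. x ^ (q - Suc i) * x ^ i) = (\<Sum>i<q. x ^ (q - 1))"
        by (rule sum.cong) (simp_all flip: power_add)
      also have "\<dots> = 0" by (simp add: q0)
      finally have "residue w \<noteq> 0" by simp
      then have "w dvd 1" by (simp add: residue_eq_0_iff)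
      moreover have "(a ^ q - a) - (b ^ q - b) = (a - b) * w"
        by (simp add: w_def right_diff_distrib flip: power_diff_sumr2)
      ultimately show "\<exists>w. w dvd 1 \<and> (a ^ q - a) - (b ^ q - b) = (a - b) * w" by blast
    qed
  qed
  then show ?thesis by (simp add: q_def)
qed

section \<open>The Teichmueller lift and square roots of one-units\<close>

context pro_p_presentation
begin

context
  assumes odd_p: "odd p" and fin: "finite (UNIV :: 'a residue_field set)"
begin

lemma two_unit: "(2 :: 'a) dvd 1"
  using of_nat_unit[of 2] odd_p by simp

lemma teichmuller: "residue (teichmuller x :: 'a) = x" "(teichmuller x :: 'a) ^ CARD('a residue_field) = teichmuller x"
  using theI'[OF teichmuller_ex1[OF fin, of x]] unfolding teichmuller_def by auto

lemma teichmuller_eqI: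
  "residue (a :: 'a) = x \<Longrightarrow> a ^ CARD('a residue_field) = a \<Longrightarrow> teichmuller x = a"
  using teichmuller_ex1[OF fin, of x] teichmuller[of x] by blast

lemma teichmuller_1: "teichmuller 1 = (1 :: 'a)"
  by (rule teichmuller_eqI) (simp_all add: residue_1)

text \<open>
  Multiplicativity is forced by uniqueness, here and for square roots and one-unit parts below.
\<close>

lemma teichmuller_mult: "teichmuller (x * y) = (teichmuller x * teichmuller y :: 'a)"
  by (rule teichmuller_eqI) (simp_all add: residue_mult power_mult_distrib teichmuller)

lemma inv_sqrt:
  assumes "residue (u :: 'a) = 1"
  shows "residue (inv_sqrt u) = 1" "(inv_sqrt u)\<^sup>2 * u = 1"
  using theI'[OF inv_sqrt_ex1[OF odd_p assms]] unfolding inv_sqrt_def by auto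

lemma inv_sqrt_mult:
  assumes "residue (u :: 'a) = 1" "residue v = 1"
  shows "inv_sqrt (u * v) = inv_sqrt u * inv_sqrt v"
proof -
  have uv: "residue (u * v) = 1" using assms by (simp add: residue_mult)
  have "(inv_sqrt u * inv_sqrt v)\<^sup>2 * (u * v) = ((inv_sqrt u)\<^sup>2 * u) * ((inv_sqrt v)\<^sup>2 * v)"
    by (simp add: power_mult_distrib mult_ac)
  also have "\<dots> = 1" using inv_sqrt assms by simp
  finally show ?thesis
    using inv_sqrt_ex1[OF odd_p uv] inv_sqrt[OF uv] inv_sqrt[OF assms(1)] inv_sqrt[OF assms(2)]
    by (metis mult_1 residue_mult)
qed

lemma one_unit_part:
  fixes d :: "'g \<Rightarrow> 'a"
  assumes "d g dvd 1"
  shows "d g = one_unit_part d g * teichmuller (residue (d g))"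
    and "residue (one_unit_part d g) = 1"
    and "teichmuller (residue (d g)) dvd (1 :: 'a)"
proof -
  define \<tau> where "\<tau> = (teichmuller (residue (d g)) :: 'a)"
  have nz: "residue (d g) \<noteq> 0" using assms by (simp add: residue_eq_0_iff)
  have \<tau>: "residue \<tau> = residue (d g)" by (simp add: \<tau>_def teichmuller)
  with nz show unit: "teichmuller (residue (d g)) dvd (1 :: 'a)"
    unfolding \<tau>_def[symmetric] using residue_eq_0_iff[of \<tau>] by simp
  then have "one_unit_part d g * \<tau> = d g * (\<tau> * inv\<^bsub>ring_of_type_algebra\<^esub> \<tau>)"
    by (simp add: one_unit_part_def \<tau>_def mult_ac)
  also have "\<dots> = d g" using unit_inverse[OF unit] by (simp add: \<tau>_def)
  finally have eq: "one_unit_part d g * \<tau> = d g" .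
  then show "d g = one_unit_part d g * teichmuller (residue (d g))" by (simp add: \<tau>_def)
  have "residue (one_unit_part d g) * residue (d g) = residue (d g)"
    using eq \<tau> by (metis residue_mult)
  with nz show "residue (one_unit_part d g) = 1" by simp
qed

lemma one_unit_part_mult:
  fixes d :: "'g \<Rightarrow> 'a"
  assumes "d x dvd 1" "d y dvd 1" "d z = d x * d y"
  shows "one_unit_part d z = one_unit_part d x * one_unit_part d y"
proof -
  have z: "d z dvd 1" using mult_dvd_mono[OF assms(1,2)] by (simp add: assms(3))
  have "one_unit_part d z * teichmuller (residue (d z)) = d z" using one_unit_part(1)[of d z] z by simp
  also have "\<dots> = (one_unit_part d x * teichmuller (residue (d x))) * (one_unit_part d y * teichmuller (residue (d y)))"
    using one_unit_part(1)[of d x] one_unit_part(1)[of d y] assms by metis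
  also have "\<dots> = (one_unit_part d x * one_unit_part d y) * teichmuller (residue (d z))"
    by (simp add: assms(3) residue_mult teichmuller_mult mult_ac)
  finally show ?thesis using unit_cancel one_unit_part(3)[of d z] z by blast
qed

text \<open>
  The square root is normalised so that twisting by \<open>s\<close> replaces \<open>d\<close> by the Teichmueller lift
  of its reduction, and does not change anything modulo the maximal ideal.
\<close>

lemma twist_scalar:
  fixes d :: "'g \<Rightarrow> 'a"
  assumes "d g dvd 1"
  defines "s \<equiv> inv_sqrt (one_unit_part d g)"
  shows "residue s = 1" "s dvd 1" "s\<^sup>2 * d g = twist_d d g"
    and "twist_d d g = teichmuller (residue (d g))"
proof -
  define w where "w = one_unit_part d g"
  have w: "residue w = 1" unfolding w_def by (rule one_unit_part(2)[of d g]) fact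
  have "residue s = 1" "s\<^sup>2 * w = 1" using inv_sqrt[OF w] by (simp_all add: s_def w_def)
  then show "residue s = 1" by simp
  then show "s dvd 1" using residue_eq_0_iff[of s] by simp
  have "w dvd 1" using w residue_eq_0_iff[of w] by simp
  define \<tau> where "\<tau> = (teichmuller (residue (d g)) :: 'a)"
  have d: "d g = w * \<tau>" unfolding w_def \<tau>_def by (rule one_unit_part(1)[of d g]) fact
  have "twist_d d g = inv\<^bsub>ring_of_type_algebra\<^esub> w * d g" by (simp add: twist_d_def w_def)
  also have "\<dots> = (w * inv\<^bsub>ring_of_type_algebra\<^esub> w) * \<tau>" by (simp add: d mult_ac)
  finally have tw: "twist_d d g = \<tau>" using unit_inverse[OF \<open>w dvd 1\<close>] by simp
  then show "twist_d d g = teichmuller (residue (d g))" by (simp add: \<tau>_def)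
  have "s\<^sup>2 * d g = (s\<^sup>2 * w) * \<tau>" by (simp add: d mult_ac)
  then show "s\<^sup>2 * d g = twist_d d g" using \<open>s\<^sup>2 * w = 1\<close> tw by simp
qed

end

end

section \<open>Lines and eigenvectors in dimension two\<close>

lemmas mat2_simps = vec_eq_iff forall_2 matrix_matrix_mult_def matrix_vector_mult_def sum_2
  mat_def trace_def det_2

text \<open>
  A line is given by a vector that spans it. Besides the whole group, \<open>S\<close> will be a subgroup or the index
  set of a commuting family.
\<close>

definition stable_line :: "('i \<Rightarrow> 'k::field ^ 2 ^ 2) \<Rightarrow> 'i set \<Rightarrow> 'k ^ 2 \<Rightarrow> bool" where
  "stable_line \<rho> S v \<longleftrightarrow> v \<noteq> 0 \<and> (\<forall>g\<in>S. \<exists>c. \<rho> g *v v = c *s v)"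

text \<open>
  As the vanishing of a determinant this is symmetric and polynomial in the entries; with the zero vector everything is
  parallel.
\<close>

definition parallel :: "'k::field ^ 2 \<Rightarrow> 'k ^ 2 \<Rightarrow> bool" where
  "parallel v w \<longleftrightarrow> v $ 1 * w $ 2 = v $ 2 * w $ 1"

lemma parallel_iff:
  assumes "v \<noteq> 0"
  shows "parallel v w \<longleftrightarrow> (\<exists>c. w = c *s v)"
proof
  assume p: "parallel v w"
  have "w = (w $ 1 / v $ 1) *s v" if "v $ 1 \<noteq> 0"
    using that p by (simp add: vec_eq_iff forall_2 parallel_def field_simps)
  moreover have "w = (w $ 2 / v $ 2) *s v" if "v $ 2 \<noteq> 0"
    using that p by (simp add: vec_eq_iff forall_2 parallel_def field_simps)
  moreover have "v $ 1 \<noteq> 0 \<or> v $ 2 \<noteq> 0"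
    using assms by (auto simp: vec_eq_iff forall_2)
  ultimately show "\<exists>c. w = c *s v" by blast
qed (auto simp: parallel_def)

lemma basis_combination:
  assumes "\<not> parallel v w"
  obtains a b where "x = a *s v + b *s w"
proof
  define D where "D = v $ 1 * w $ 2 - v $ 2 * w $ 1"
  have "D \<noteq> 0" using assms by (simp add: D_def parallel_def)
  have "D * x $ 1 = (x $ 1 * w $ 2 - x $ 2 * w $ 1) * v $ 1 + (v $ 1 * x $ 2 - v $ 2 * x $ 1) * w $ 1"
    "D * x $ 2 = (x $ 1 * w $ 2 - x $ 2 * w $ 1) * v $ 2 + (v $ 1 * x $ 2 - v $ 2 * x $ 1) * w $ 2"
    by (simp_all add: D_def algebra_simps)
  then show "x = ((x $ 1 * w $ 2 - x $ 2 * w $ 1) / D) *s v + ((v $ 1 * x $ 2 - v $ 2 * x $ 1) / D) *s w"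
    using \<open>D \<noteq> 0\<close>
    by (simp add: vec_eq_iff forall_2 eq_divide_eq mult.commute[of _ D] flip: add_divide_distrib)
qed

text \<open>
  In a plane the proper nonzero subspaces are the lines.
\<close>

lemma not_irreducible_rep_iff:
  "\<not> irreducible_rep G \<rho> \<longleftrightarrow> (\<exists>v. stable_line \<rho> (carrier G) v)"
  for \<rho> :: "'g \<Rightarrow> 'k::field ^ 2 ^ 2"
proof
  assume "\<not> irreducible_rep G \<rho>"
  then obtain W where W: "vec.subspace W" and inv: "\<And>g v. g \<in> carrier G \<Longrightarrow> v \<in> W \<Longrightarrow> \<rho> g *v v \<in> W"
    and "W \<noteq> {0}" "W \<noteq> UNIV"
    unfolding irreducible_rep_def invariant_subspace_def by blast
  moreover have "0 \<in> W" using W by (rule vec.subspace_0)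
  ultimately obtain v where v: "v \<in> W" "v \<noteq> 0" by blast
  have "parallel v w" if "w \<in> W" for w
  proof (rule ccontr)
    assume "\<not> parallel v w"
    then have "x \<in> W" for x
      by (rule basis_combination[of v w x]) (metis W v(1) that vec.subspace_add vec.subspace_scale)
    with \<open>W \<noteq> UNIV\<close> show False by blast
  qed
  with v inv show "\<exists>v. stable_line \<rho> (carrier G) v"
    unfolding stable_line_def by (metis parallel_iff)
next
  assume "\<exists>v. stable_line \<rho> (carrier G) v"
  then obtain v where v: "v \<noteq> 0" "\<And>g. g \<in> carrier G \<Longrightarrow> \<exists>c. \<rho> g *v v = c *s v"
    unfolding stable_line_def by blast
  define W where "W = range (\<lambda>c. c *s v)"
  have "vec.subspace W"
    unfolding W_def vec.subspace_def
    by (auto simp: image_iff intro: exI[of _ 0] vec.scale_left_distrib[symmetric])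
  moreover have "\<rho> g *v x \<in> W" if "g \<in> carrier G" "x \<in> W" for g x
  proof -
    from that(2) obtain a where "x = a *s v" by (auto simp: W_def)
    moreover obtain c where "\<rho> g *v v = c *s v" using v(2)[OF \<open>g \<in> carrier G\<close>] by blast
    ultimately have "\<rho> g *v x = (a * c) *s v" by (simp add: vec.scale)
    then show ?thesis by (auto simp: W_def)
  qed
  moreover have "W \<noteq> {0}" using v(1) unfolding W_def by (metis range_eqI singletonD vec.scale_one)
  moreover have "W \<noteq> UNIV"
  proof
    assume "W = UNIV"
    then have "parallel v x" for x
      using parallel_iff[OF v(1), of x] by (auto simp: W_def)
    from this[of "axis 1 1"] this[of "axis 2 1"] have "v = 0"
      by (simp add: parallel_def axis_def vec_eq_iff forall_2)
    with v(1) show False by contradiction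
  qed
  ultimately show "\<not> irreducible_rep G \<rho>"
    unfolding irreducible_rep_def invariant_subspace_def by blast
qed

text \<open>
  A nonzero singular matrix has rank one. The functional \<open>f\<close> is a nonzero row, and \<open>v\<close> is a
  column divided by one of its entries.
\<close>

lemma singular_factor:
  fixes N :: "'k::field ^ 2 ^ 2"
  assumes "N \<noteq> 0" "det N = 0"
  obtains v f where "v \<noteq> 0" "f \<noteq> 0" "\<And>i j. N $ i $ j = v $ i * f $ j"
proof -
  have det: "N $ 1 $ 1 * N $ 2 $ 2 = N $ 1 $ 2 * N $ 2 $ 1" using assms(2) by (simp add: det_2)
  obtain k where "row k N \<noteq> 0"
    using assms(1) by (auto simp: vec_eq_iff row_def)
  then have f: "N $ k \<noteq> 0" by (simp add: row_def)
  obtain l where l: "N $ k $ l \<noteq> 0" using f by (auto simp: vec_eq_iff)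
  define v :: "'k ^ 2" where "v = (\<chi> i. N $ i $ l / N $ k $ l)"
  have "N $ i $ j = v $ i * N $ k $ j" for i j
  proof -
    have "\<forall>i j. N $ i $ j * N $ k $ l = N $ i $ l * N $ k $ j"
      using det exhaust_2[of k] exhaust_2[of l] by (auto simp: forall_2 mult.commute)
    then show ?thesis using l by (simp add: v_def eq_divide_eq)
  qed
  moreover have "v $ k = 1" using l by (simp add: v_def)
  then have "v \<noteq> 0" by auto
  ultimately show ?thesis using that f by blast
qed

lemma parallel_if_orthogonal:
  fixes f :: "'k::field ^ 2"
  assumes "f \<noteq> 0" "f $ 1 * v $ 1 + f $ 2 * v $ 2 = 0" "f $ 1 * w $ 1 + f $ 2 * w $ 2 = 0"
  shows "parallel v w"
proof -
  have "f $ 1 * (v $ 1 * w $ 2 - v $ 2 * w $ 1) = (f $ 1 * v $ 1 + f $ 2 * v $ 2) * w $ 2 - (f $ 1 * w $ 1 + f $ 2 * w $ 2) * v $ 2"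
    "f $ 2 * (v $ 1 * w $ 2 - v $ 2 * w $ 1) = (f $ 1 * w $ 1 + f $ 2 * w $ 2) * v $ 1 - (f $ 1 * v $ 1 + f $ 2 * v $ 2) * w $ 1"
    by (simp_all add: algebra_simps)
  then have "f $ 1 * (v $ 1 * w $ 2 - v $ 2 * w $ 1) = 0" "f $ 2 * (v $ 1 * w $ 2 - v $ 2 * w $ 1) = 0"
    using assms by simp_all
  moreover have "f $ 1 \<noteq> 0 \<or> f $ 2 \<noteq> 0"
    using assms(1) by (auto simp: vec_eq_iff forall_2)
  ultimately show ?thesis by (auto simp: parallel_def)
qed

lemma kernel_parallel:
  fixes N :: "'k::field ^ 2 ^ 2"
  assumes "N \<noteq> 0" "N *v v = 0" "N *v w = 0"
  shows "parallel v w"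
proof -
  obtain k where "N $ k \<noteq> 0" using assms(1) by (metis vec_eq_iff zero_index)
  then show ?thesis
    using assms(2,3) by (intro parallel_if_orthogonal[of "N $ k"]) (auto simp: vec_eq_iff matrix_vector_mult_def sum_2)
qed

lemma det_diff_mat:
  fixes M :: "'k::field ^ 2 ^ 2"
  shows "det (M - mat c) = c\<^sup>2 - trace M * c + det M"
  by (simp add: mat2_simps algebra_simps power2_eq_square)

lemma eigenvalue_root:
  fixes M :: "'k::field ^ 2 ^ 2"
  assumes "v \<noteq> 0" "M *v v = c *s v"
  shows "c\<^sup>2 - trace M * c + det M = 0"
proof -
  have e: "M$1$1 * v$1 + M$1$2 * v$2 = c * v$1" "M$2$1 * v$1 + M$2$2 * v$2 = c * v$2"
    using assms(2) by (simp_all add: mat2_simps)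
  have "(c\<^sup>2 - trace M * c + det M) * v$1
      = (c - M$2$2) * (c * v$1 - (M$1$1 * v$1 + M$1$2 * v$2)) + M$1$2 * (c * v$2 - (M$2$1 * v$1 + M$2$2 * v$2))"
    "(c\<^sup>2 - trace M * c + det M) * v$2
      = (c - M$1$1) * (c * v$2 - (M$2$1 * v$1 + M$2$2 * v$2)) + M$2$1 * (c * v$1 - (M$1$1 * v$1 + M$1$2 * v$2))"
    by (simp_all add: mat2_simps power2_eq_square algebra_simps)
  then have "(c\<^sup>2 - trace M * c + det M) * v$1 = 0" "(c\<^sup>2 - trace M * c + det M) * v$2 = 0"
    by (simp_all add: e)
  then show ?thesis using assms(1) by (auto simp: vec_eq_iff forall_2)
qed

text \<open>
  If \<open>M - c\<close> is not zero it has the form \<open>v f\<close> with a vector \<open>v\<close> and a functional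
  \<open>f\<close>, and its kernel is spanned by \<open>(- f 2, f 1)\<close>.
\<close>

lemma eigenvector_of_root:
  fixes M :: "'k::field ^ 2 ^ 2"
  assumes "c\<^sup>2 - trace M * c + det M = 0"
  obtains v where "v \<noteq> 0" "M *v v = c *s v"
proof (cases "M = mat c")
  case True
  have "axis 1 1 \<noteq> (0 :: 'k^2)" by (simp add: axis_eq_0_iff)
  moreover have "M *v x = c *s x" for x by (simp add: True mat2_simps)
  ultimately show ?thesis using that by blast
next
  case False
  have "det (M - mat c) = 0"
    using assms by (simp add: det_diff_mat)
  then obtain v f where vf: "v \<noteq> 0" "f \<noteq> 0" "\<And>i j. (M - mat c) $ i $ j = v $ i * f $ j"
    using singular_factor[of "M - mat c"] False by auto
  define w :: "'k^2" where "w = vector [- f$2, f$1]"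
  have "w \<noteq> 0" using vf(2) by (auto simp: w_def vec_eq_iff forall_2)
  moreover have "M $ i $ j = v $ i * f $ j + (if i = j then c else 0)" for i j
    using vf(3)[of i j] by (simp add: mat_def algebra_simps)
  then have "M *v w = c *s w"
    by (simp add: mat2_simps w_def algebra_simps)
  ultimately show ?thesis using that by blast
qed

lemma eigenvector_exists:
  fixes M :: "'k::alg_closed_field ^ 2 ^ 2"
  obtains c v where "v \<noteq> 0" "M *v v = c *s v"
proof -
  have "Polynomial.degree [:det M, - trace M, 1:] > 0" by simp
  then obtain c where "poly [:det M, - trace M, 1:] c = 0"
    using alg_closed_imp_poly_has_root by blast
  then have "c\<^sup>2 - trace M * c + det M = 0" by (simp add: algebra_simps power2_eq_square)
  then show ?thesis by (rule eigenvector_of_root) (rule that)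
qed

text \<open>
  The third vector is a combination of the first two with nonzero coefficients, so all three eigenvalues agree.
\<close>

lemma three_eigenvectors_scalar:
  fixes M :: "'k::field ^ 2 ^ 2"
  assumes np: "\<not> parallel v1 v2" "\<not> parallel v1 v3" "\<not> parallel v2 v3"
    and e: "M *v v1 = c1 *s v1" "M *v v2 = c2 *s v2" "M *v v3 = c3 *s v3"
  shows "M = mat c1"
proof -
  define N where "N = M - mat c3"
  have N: "N *v v1 = (c1 - c3) *s v1" "N *v v2 = (c2 - c3) *s v2" "N *v v3 = 0"
    using e by (simp_all add: N_def mat2_simps algebra_simps)
  obtain a b where v3: "v3 = a *s v1 + b *s v2" using np(1) by (rule basis_combination)
  have a: "a \<noteq> 0" "b \<noteq> 0" using np v3 by (auto simp: parallel_def)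
  have "N *v v3 = (a * (c1 - c3)) *s v1 + (b * (c2 - c3)) *s v2"
    unfolding v3 matrix_vector_right_distrib vec.scale N(1,2) by (simp only: vec.scale_scale)
  then have z: "(a * (c1 - c3)) *s v1 + (b * (c2 - c3)) *s v2 = 0" using N by simp
  have indep: "p = 0 \<and> q = 0" if "p *s v1 + q *s v2 = 0" for p q
  proof -
    have "p * v1$1 + q * v2$1 = 0" "p * v1$2 + q * v2$2 = 0"
      using that by (simp_all add: vec_eq_iff forall_2)
    moreover have "p * (v1$1 * v2$2 - v1$2 * v2$1) = (p * v1$1 + q * v2$1) * v2$2 - (p * v1$2 + q * v2$2) * v2$1"
      "q * (v1$1 * v2$2 - v1$2 * v2$1) = (p * v1$2 + q * v2$2) * v1$1 - (p * v1$1 + q * v2$1) * v1$2"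
      by (simp_all add: algebra_simps)
    ultimately have "p * (v1$1 * v2$2 - v1$2 * v2$1) = 0" "q * (v1$1 * v2$2 - v1$2 * v2$1) = 0"
      by simp_all
    then show ?thesis using np(1) by (simp add: parallel_def)
  qed
  have c: "c1 = c3" "c2 = c3" using indep[OF z] a by simp_all
  have "N = 0" using kernel_parallel[of N v1 v2] N(1,2) np(1) by (auto simp: c)
  then show ?thesis by (simp add: N_def c)
qed

section \<open>Two-dimensional representations and their traces\<close>

lemma group_GL: "group (GL :: ('k::field ^ 'n ^ 'n) monoid)"
proof (rule groupI)
  fix x :: "'k ^ 'n ^ 'n" assume "x \<in> carrier GL"
  then obtain y where "x ** y = mat 1" "y ** x = mat 1" by (auto simp: GL_def invertible_def)
  then show "\<exists>y\<in>carrier GL. y \<otimes>\<^bsub>GL\<^esub> x = \<one>\<^bsub>GL\<^esub>" by (auto simp: GL_def invertible_def)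
qed (auto simp: GL_def matrix_mul_assoc invertible_det_nz det_mul)

locale two_dim_rep = group G for G :: "('g, 'e) monoid_scheme" (structure) +
  fixes \<rho> :: "'g \<Rightarrow> 'k::field ^ 2 ^ 2"
  assumes rep_hom: "\<rho> \<in> hom G GL"
begin

lemma rep_group_hom: "group_hom G GL \<rho>"
  by (intro group_hom.intro is_group group_GL group_hom_axioms.intro rep_hom)

lemma rep_mult: "x \<in> carrier G \<Longrightarrow> y \<in> carrier G \<Longrightarrow> \<rho> (x \<otimes> y) = \<rho> x ** \<rho> y"
  using hom_mult[OF rep_hom] by (simp add: GL_def)

lemma rep_one: "\<rho> \<one> = mat 1"
  using hom_one[OF rep_hom is_group group_GL] by (simp add: GL_def)

lemma rep_det_nonzero: "x \<in> carrier G \<Longrightarrow> det (\<rho> x) \<noteq> 0"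
  using hom_in_carrier[OF rep_hom] by (simp add: GL_def invertible_det_nz)

lemma rep_inv_right: "x \<in> carrier G \<Longrightarrow> \<rho> x ** \<rho> (inv x) = mat 1"
  by (simp add: rep_one flip: rep_mult)

lemma rep_inv_left: "x \<in> carrier G \<Longrightarrow> \<rho> (inv x) ** \<rho> x = mat 1"
  by (simp add: rep_one flip: rep_mult)

lemma rep_vec_nonzero:
  assumes "x \<in> carrier G" "v \<noteq> 0"
  shows "\<rho> x *v v \<noteq> 0"
proof
  assume "\<rho> x *v v = 0"
  then have "(\<rho> (inv x) ** \<rho> x) *v v = 0" by (simp flip: matrix_vector_mul_assoc)
  with assms show False by (simp add: rep_inv_left)
qed

text \<open>
  Write the nilpotent matrix as \<open>N = v f\<close> with \<open>f(v) = 0\<close>. Then \<open>tr (N \<rho>(g)) =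
  f(\<rho>(g) v)\<close>, so the condition on traces says that \<open>\<rho>(g) v\<close> lies in the kernel of
  \<open>f\<close>, which is the line of \<open>v\<close>. This is how information on traces produces an invariant line,
  without Burnside's theorem on the span of the image.
\<close>

lemma stable_line_if_nilpotent_trace_zero:
  assumes N: "N \<noteq> 0" "det N = 0" "trace N = 0" and tr: "\<And>g. g \<in> S \<Longrightarrow> trace (N ** \<rho> g) = 0"
  obtains v where "stable_line \<rho> S v" "N *v v = 0" "\<And>w. parallel v (N *v w)"
proof -
  obtain v f where vf: "v \<noteq> 0" "f \<noteq> 0" "\<And>i j. N $ i $ j = v $ i * f $ j"
    using singular_factor[OF N(1,2)] by metis
  have fv: "f$1 * v$1 + f$2 * v$2 = 0"
    using N(3) by (simp add: trace_def sum_2 vf(3) mult.commute)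
  have "\<exists>c. \<rho> g *v v = c *s v" if "g \<in> S" for g
  proof -
    have "f$1 * (\<rho> g *v v)$1 + f$2 * (\<rho> g *v v)$2 = 0"
      using tr[OF that] by (simp add: mat2_simps vf(3) algebra_simps)
    with fv have "parallel v (\<rho> g *v v)" using parallel_if_orthogonal[OF vf(2)] by blast
    then show ?thesis using parallel_iff[OF vf(1)] by blast
  qed
  then have "stable_line \<rho> S v" using vf(1) by (simp add: stable_line_def)
  moreover have "N *v v = 0"
    using fv by (simp add: mat2_simps vf(3) mult.assoc flip: distrib_left)
  moreover have "parallel v (N *v w)" for w
    by (simp add: parallel_def mat2_simps vf(3) algebra_simps)
  ultimately show ?thesis by (rule that)
qed

text \<open>
  The characters are the eigenvalue on the line and the eigenvalue on the quotient, the latter as the determinant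
  divided by the former.
\<close>

lemma stable_line_imp_reducible:
  assumes "stable_line \<rho> (carrier G) v"
  shows "reducible_rep G \<rho>"
proof -
  have "\<forall>g\<in>carrier G. \<exists>c. \<rho> g *v v = c *s v" and v: "v \<noteq> 0"
    using assms by (auto simp: stable_line_def)
  then obtain c where c: "\<And>g. g \<in> carrier G \<Longrightarrow> \<rho> g *v v = c g *s v" by metis
  have root: "(c g)\<^sup>2 - trace (\<rho> g) * c g + det (\<rho> g) = 0" if "g \<in> carrier G" for g
    using eigenvalue_root[OF v c[OF that]] .
  have nz: "c g \<noteq> 0" if "g \<in> carrier G" for g
    using root[OF that] rep_det_nonzero[OF that] by auto
  have mult: "c (g \<otimes> h) = c g * c h" if "g \<in> carrier G" "h \<in> carrier G" for g h
  proof -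
    have "c (g \<otimes> h) *s v = \<rho> (g \<otimes> h) *v v" using that by (simp add: c)
    also have "\<dots> = \<rho> g *v (\<rho> h *v v)" using that by (simp add: rep_mult matrix_vector_mul_assoc)
    also have "\<dots> = (c g * c h) *s v" using that by (simp add: c vec.scale mult.commute)
    finally show ?thesis using v by simp
  qed
  have "c \<in> hom G unit_group"
    unfolding hom_unit_group_iff using nz mult by (simp add: dvd_field_iff)
  moreover have "(\<lambda>g. det (\<rho> g) / c g) \<in> hom G unit_group"
    unfolding hom_unit_group_iff using nz mult rep_det_nonzero
    by (simp add: dvd_field_iff rep_mult det_mul)
  moreover have "trace (\<rho> g) = c g + det (\<rho> g) / c g" if "g \<in> carrier G" for g
    using root[OF that] nz[OF that] by (simp add: field_simps power2_eq_square)
  ultimately show ?thesis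
    unfolding reducible_rep_def pseudo_reducible_def
    by (intro bexI[of _ c] bexI[of _ "\<lambda>g. det (\<rho> g) / c g"] ballI)
qed

text \<open>
  Since 2 is invertible, the trace determines the determinant, so \<open>\<rho>(g)\<close> has the eigenvalues
  \<open>\<alpha>(g)\<close> and \<open>\<beta>(g)\<close>. If the two characters agree, all \<open>\<rho>(g) -
  \<alpha>(g)\<close> are nilpotent and \<open>stable_line_if_nilpotent_trace_zero\<close> applies to one of them that
  is not zero; if all are zero, every line is stable. If they differ at \<open>g\<close>, then \<open>\<rho>(g) -
  \<beta>(g)\<close> has the form \<open>v f\<close>, and in the basis of \<open>v\<close> and the kernel of
  \<open>f\<close> the upper left entry of \<open>\<rho>(h)\<close> is \<open>\<alpha>(h)\<close>. That this entry is
  multiplicative means that each lower left entry times each upper right entry is zero, so that all entries in one of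
  these two places vanish.
\<close>

lemma reducible_imp_stable_line:
  assumes two: "(2 :: 'k) \<noteq> 0" and "reducible_rep G \<rho>"
  shows "\<exists>v. stable_line \<rho> (carrier G) v"
proof -
  obtain \<alpha> \<beta> where \<alpha>: "\<alpha> \<in> hom G unit_group" "\<beta> \<in> hom G unit_group"
    and tr: "\<And>g. g \<in> carrier G \<Longrightarrow> trace (\<rho> g) = \<alpha> g + \<beta> g"
    using assms(2) unfolding reducible_rep_def pseudo_reducible_def by blast
  have mult: "\<alpha> (g \<otimes> h) = \<alpha> g * \<alpha> h" "\<beta> (g \<otimes> h) = \<beta> g * \<beta> h"
    if "g \<in> carrier G" "h \<in> carrier G" for g h
    using \<alpha> that by (simp_all add: hom_unit_group_iff)
  have det: "det (\<rho> g) = \<alpha> g * \<beta> g" if "g \<in> carrier G" for g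
  proof -
    have "2 * det (\<rho> g) = (trace (\<rho> g))\<^sup>2 - trace (\<rho> g ** \<rho> g)"
      by (simp add: mat2_simps power2_eq_square algebra_simps)
    also have "\<dots> = (\<alpha> g + \<beta> g)\<^sup>2 - (\<alpha> g * \<alpha> g + \<beta> g * \<beta> g)"
      using that by (simp add: tr mult flip: rep_mult)
    also have "\<dots> = 2 * (\<alpha> g * \<beta> g)" by (simp add: power2_eq_square algebra_simps)
    finally show ?thesis using two by simp
  qed
  have det_shift: "det (\<rho> g - mat (\<alpha> g)) = 0" "det (\<rho> g - mat (\<beta> g)) = 0" if "g \<in> carrier G" for g
    using tr[OF that] det[OF that] by (simp_all add: det_diff_mat power2_eq_square algebra_simps)
  show ?thesis
  proof (cases "\<forall>g\<in>carrier G. \<alpha> g = \<beta> g")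
    case same: True
    show ?thesis
    proof (cases "\<forall>g\<in>carrier G. \<rho> g = mat (\<alpha> g)")
      case True
      then have "\<rho> g *v axis 1 1 = \<alpha> g *s axis 1 1" if "g \<in> carrier G" for g
        using that by (simp add: mat2_simps)
      moreover have "axis 1 1 \<noteq> (0 :: 'k^2)" by (simp add: axis_eq_0_iff)
      ultimately show ?thesis unfolding stable_line_def by blast
    next
      case False
      then obtain g where g: "g \<in> carrier G" "\<rho> g - mat (\<alpha> g) \<noteq> 0" by auto
      have "trace ((\<rho> g - mat (\<alpha> g)) ** \<rho> h) = 0" if "h \<in> carrier G" for h
      proof -
        have "trace ((\<rho> g - mat (\<alpha> g)) ** \<rho> h) = trace (\<rho> (g \<otimes> h)) - \<alpha> g * trace (\<rho> h)"
          using g that by (simp add: rep_mult mat2_simps algebra_simps)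
        then show ?thesis using g that same by (simp add: tr mult algebra_simps)
      qed
      moreover have "trace (\<rho> g - mat (\<alpha> g)) = 0"
        using tr[OF g(1)] same g(1) by (simp add: mat2_simps algebra_simps)
      ultimately show ?thesis
        using stable_line_if_nilpotent_trace_zero[OF g(2) det_shift(1)[OF g(1)]] by metis
    qed
  next
    case False
    then obtain g where g: "g \<in> carrier G" and ne: "\<alpha> g \<noteq> \<beta> g" by blast
    define N where "N = \<rho> g - mat (\<beta> g)"
    have trN: "trace N = \<alpha> g - \<beta> g" using tr[OF g] by (simp add: N_def mat2_simps algebra_simps)
    with ne have "N \<noteq> 0" by (auto simp: trace_def)
    moreover have "det N = 0" unfolding N_def using det_shift g by blast
    ultimately obtain v f where vf: "v \<noteq> 0" "f \<noteq> 0" "\<And>i j. N $ i $ j = v $ i * f $ j"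
      using singular_factor by metis
    define F where "F x = f$1 * x$1 + f$2 * x$2" for x :: "'k^2"
    have F_lin: "F (x + y) = F x + F y" "F (a *s x) = a * F x" for x y a
      by (simp_all add: F_def algebra_simps)
    have par: "parallel x y" if "F x = 0" "F y = 0" for x y
      using parallel_if_orthogonal[OF vf(2)] that by (simp add: F_def)
    have Fv: "F v = \<alpha> g - \<beta> g"
      using trN by (simp add: F_def trace_def sum_2 vf(3) mult.commute)
    have Fh: "F (\<rho> h *v v) = \<alpha> h * F v" if "h \<in> carrier G" for h
    proof -
      have "F (\<rho> h *v v) = trace (N ** \<rho> h)"
        by (simp add: F_def mat2_simps vf(3) algebra_simps)
      also have "\<dots> = trace (\<rho> (g \<otimes> h)) - \<beta> g * trace (\<rho> h)"
        using g that by (simp add: N_def rep_mult mat2_simps algebra_simps)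
      finally show ?thesis using g that by (simp add: Fv tr mult algebra_simps)
    qed
    define w :: "'k^2" where "w = vector [- f$2, f$1]"
    have w: "w \<noteq> 0" "F w = 0" using vf(2) by (auto simp: w_def F_def vec_eq_iff forall_2)
    have "\<exists>z. \<rho> h *v v = \<alpha> h *s v + z *s w" if "h \<in> carrier G" for h
    proof -
      have "F (\<rho> h *v v + (- \<alpha> h) *s v) = 0" using Fh[OF that] by (simp only: F_lin) simp
      from par[OF w(2) this] obtain z where "\<rho> h *v v + (- \<alpha> h) *s v = z *s w"
        using parallel_iff[OF w(1)] by blast
      then have "\<rho> h *v v = \<alpha> h *s v + z *s w" by (simp add: algebra_simps)
      then show ?thesis ..
    qed
    then obtain z where z: "\<And>h. h \<in> carrier G \<Longrightarrow> \<rho> h *v v = \<alpha> h *s v + z h *s w" by metis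
    have prod: "z h' * F (\<rho> h *v w) = 0" if h: "h \<in> carrier G" "h' \<in> carrier G" for h h'
    proof -
      have "\<alpha> h * \<alpha> h' * F v = F (\<rho> (h \<otimes> h') *v v)" using h by (simp add: Fh mult)
      also have "\<dots> = F (\<rho> h *v (\<rho> h' *v v))"
        using h by (simp add: rep_mult matrix_vector_mul_assoc)
      also have "\<dots> = F (\<alpha> h' *s (\<rho> h *v v) + z h' *s (\<rho> h *v w))"
        by (simp add: z[OF h(2)] matrix_vector_right_distrib vec.scale)
      also have "\<dots> = \<alpha> h' * \<alpha> h * F v + z h' * F (\<rho> h *v w)"
        using h by (simp add: F_lin Fh)
      finally show ?thesis by (simp add: algebra_simps)
    qed
    show ?thesis
    proof (cases "\<forall>h\<in>carrier G. z h = 0")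
      case True
      then have "stable_line \<rho> (carrier G) v" using z vf(1) by (force simp: stable_line_def)
      then show ?thesis ..
    next
      case False
      then have "F (\<rho> h *v w) = 0" if "h \<in> carrier G" for h using prod that by auto
      then have "stable_line \<rho> (carrier G) w"
        using par[OF w(2)] parallel_iff[OF w(1)] w(1) by (simp add: stable_line_def)
      then show ?thesis ..
    qed
  qed
qed

lemma reducible_rep_iff:
  assumes "(2 :: 'k) \<noteq> 0"
  shows "reducible_rep G \<rho> \<longleftrightarrow> (\<exists>v. stable_line \<rho> (carrier G) v)"
  using reducible_imp_stable_line[OF assms] stable_line_imp_reducible by blast

text \<open>
  For \<open>g\<close> in the kernel of the pseudorepresentation, \<open>N = \<rho>(g) - 1\<close> is nilpotent and
  \<open>tr (N \<rho>(h)) = 0\<close> for all \<open>h\<close>. If \<open>N\<close> were not zero, its kernel would be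
  an invariant line that is also its image. By semisimplicity there is an invariant complement; \<open>N\<close> maps it
  to itself but also to the line, so \<open>N\<close> kills both.
\<close>

lemma semisimple_kernel:
  assumes ss: "semisimple_rep G \<rho>"
  shows "kernel G GL \<rho> = pseudo_kernel G (\<lambda>g. trace (\<rho> g)) (\<lambda>g. det (\<rho> g))"
proof
  show "kernel G GL \<rho> \<subseteq> pseudo_kernel G (\<lambda>g. trace (\<rho> g)) (\<lambda>g. det (\<rho> g))"
    by (auto simp: kernel_def pseudo_kernel_def GL_def rep_mult)
  show "pseudo_kernel G (\<lambda>g. trace (\<rho> g)) (\<lambda>g. det (\<rho> g)) \<subseteq> kernel G GL \<rho>"
  proof
    fix g assume "g \<in> pseudo_kernel G (\<lambda>g. trace (\<rho> g)) (\<lambda>g. det (\<rho> g))"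
    then have g: "g \<in> carrier G" "det (\<rho> g) = 1"
      and tr: "\<And>x. x \<in> carrier G \<Longrightarrow> trace (\<rho> (g \<otimes> x)) = trace (\<rho> x)"
      by (auto simp: pseudo_kernel_def)
    have tr2: "trace (\<rho> g) = 2"
      using tr[OF one_closed] g by (simp add: rep_one trace_def mat_def sum_2)
    define N where "N = \<rho> g - mat 1"
    have "N = 0"
    proof (rule ccontr)
      assume N0: "N \<noteq> 0"
      have "det N = det (\<rho> g) - trace (\<rho> g) + 1" "trace N = trace (\<rho> g) - 2"
        by (simp_all add: N_def mat2_simps algebra_simps)
      then have N: "det N = 0" "trace N = 0" using g tr2 by simp_all
      have "trace (N ** \<rho> h) = 0" if "h \<in> carrier G" for h
      proof -
        have "trace (N ** \<rho> h) = trace (\<rho> (g \<otimes> h)) - trace (\<rho> h)"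
          using g that by (simp add: N_def rep_mult mat2_simps algebra_simps)
        then show ?thesis using tr[OF that] by simp
      qed
      then obtain v where v: "stable_line \<rho> (carrier G) v" "N *v v = 0" "\<And>w. parallel v (N *v w)"
        using stable_line_if_nilpotent_trace_zero[OF N0 N] by metis
      have v0: "v \<noteq> 0" using v(1) by (simp add: stable_line_def)
      define W where "W = range (\<lambda>c. c *s v)"
      have W_iff: "x \<in> W \<longleftrightarrow> parallel v x" for x
        unfolding W_def using parallel_iff[OF v0] by auto
      have "invariant_subspace G \<rho> W"
        unfolding invariant_subspace_def vec.subspace_def
      proof (intro conjI ballI allI)
        fix h x assume h: "h \<in> carrier G" "x \<in> W"
        obtain a where "x = a *s v" using h by (auto simp: W_def)
        moreover obtain c where "\<rho> h *v v = c *s v" using v(1) h by (auto simp: stable_line_def)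
        ultimately show "\<rho> h *v x \<in> W" by (simp add: vec.scale W_iff parallel_def)
      qed (auto simp: W_iff parallel_def algebra_simps)
      then obtain W' where W': "invariant_subspace G \<rho> W'" "W \<inter> W' = {0}"
        and sum: "\<forall>x. \<exists>w\<in>W. \<exists>w'\<in>W'. x = w + w'"
        using ss[unfolded semisimple_rep_def, rule_format] by metis
      obtain x where "N *v x \<noteq> 0"
        using N0 by (metis matrix_eq matrix_vector_mult_0)
      obtain w w' where w: "w \<in> W" "w' \<in> W'" "x = w + w'" using sum by metis
      have "N *v w = 0" using w(1) v(2) by (auto simp: W_def vec.scale)
      then have "N *v w' \<noteq> 0"
        using w(3) \<open>N *v x \<noteq> 0\<close> by (simp add: matrix_vector_right_distrib)
      moreover have "N *v w' \<in> W" using v(3) by (simp add: W_iff)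
      moreover have "N *v w' = \<rho> g *v w' - w'" by (simp add: N_def matrix_vector_mult_diff_rdistrib)
      then have "N *v w' \<in> W'"
        using W'(1) g w(2) by (simp add: invariant_subspace_def vec.subspace_diff)
      ultimately show False using W'(2) by blast
    qed
    then show "g \<in> kernel G GL \<rho>" using g by (simp add: N_def kernel_def GL_def)
  qed
qed

end

section \<open>Representations with a stable line over a subgroup of finite index\<close>

lemma commuting_matrix_eigenvector:
  fixes z :: "'k::field ^ 2 ^ 2"
  assumes "z \<noteq> mat c" "v \<noteq> 0" "z *v v = c *s v" "M ** z = z ** M"
  shows "\<exists>a. M *v v = a *s v"
proof -
  have "z *v (M *v v) = M *v (z *v v)" by (simp add: matrix_vector_mul_assoc assms(4))
  also have "\<dots> = c *s (M *v v)" by (simp add: assms(3) vec.scale)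
  finally have "(z - mat c) *v (M *v v) = 0" by (simp add: mat2_simps algebra_simps)
  moreover have "(z - mat c) *v v = 0" using assms(3) by (simp add: mat2_simps algebra_simps)
  moreover have "z - mat c \<noteq> 0" using assms(1) by simp
  ultimately show ?thesis using kernel_parallel parallel_iff[OF assms(2)] by blast
qed

text \<open>
  Any eigenline of a member that is not a scalar is stable under all matrices that commute with it.
\<close>

lemma commuting_stable_line:
  fixes \<rho> :: "'i \<Rightarrow> 'k::alg_closed_field ^ 2 ^ 2"
  assumes comm: "\<And>g h. g \<in> S \<Longrightarrow> h \<in> S \<Longrightarrow> \<rho> g ** \<rho> h = \<rho> h ** \<rho> g"
  shows "\<exists>v. stable_line \<rho> S v"
proof (cases "\<forall>g\<in>S. \<exists>c. \<rho> g = mat c")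
  case True
  have "mat c *v axis 1 1 = c *s (axis 1 1 :: 'k ^ 2)" for c :: 'k by (simp add: mat2_simps)
  with True have "\<exists>c. \<rho> g *v axis 1 1 = c *s axis 1 1" if "g \<in> S" for g
    using that by metis
  moreover have "axis 1 1 \<noteq> (0 :: 'k^2)" by (simp add: axis_eq_0_iff)
  ultimately show ?thesis unfolding stable_line_def by blast
next
  case False
  then obtain g where g: "g \<in> S" "\<And>c. \<rho> g \<noteq> mat c" by blast
  obtain c v where "v \<noteq> 0" "\<rho> g *v v = c *s v" by (rule eigenvector_exists)
  then have "stable_line \<rho> S v"
    unfolding stable_line_def using commuting_matrix_eigenvector[OF g(2)] comm[OF _ g(1)] by simp
  then show ?thesis ..
qed

text \<open>
  If \<open>D\<close> and \<open>D M\<close> have trace zero then \<open>D M D\<inverse>\<close> is the adjugate of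
  \<open>M\<close>. On matrices with this property conjugation by \<open>D\<close> preserves the order of products, and
  the adjugate reverses it.
\<close>

lemma commute_if_traces_vanish:
  fixes D M N :: "'k::field ^ 2 ^ 2"
  assumes D: "det D \<noteq> 0" "trace D = 0"
    and tr: "trace (D ** M) = 0" "trace (D ** N) = 0" "trace (D ** (M ** N)) = 0"
  shows "M ** N = N ** M"
proof -
  define adj :: "'k ^ 2 ^ 2 \<Rightarrow> 'k ^ 2 ^ 2" where "adj A = mat (trace A) - A" for A
  have D22: "D $ 2 $ 2 = - D $ 1 $ 1"
    using D(2) by (simp add: trace_def sum_2 eq_neg_iff_add_eq_0 add.commute)
  have swap: "D ** A = adj A ** D" if "trace (D ** A) = 0" for A
    using that by (simp add: adj_def mat2_simps D22 algebra_simps)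
  have adj_mult: "adj (A ** B) = adj B ** adj A" for A B
    by (simp add: adj_def mat2_simps algebra_simps)
  have "D ** (N ** M) = adj N ** (D ** M)" by (simp add: matrix_mul_assoc swap[OF tr(2)])
  also have "\<dots> = adj (M ** N) ** D" by (simp add: swap[OF tr(1)] adj_mult matrix_mul_assoc)
  also have "\<dots> = D ** (M ** N)" by (simp add: swap[OF tr(3)])
  finally have eq: "D ** (N ** M) = D ** (M ** N)" .
  obtain E where E: "E ** D = mat 1" using D(1) by (metis invertible_def invertible_det_nz)
  have "E ** D ** (N ** M) = E ** D ** (M ** N)" using eq by (simp flip: matrix_mul_assoc)
  then show ?thesis by (simp add: E)
qed

text \<open>
  With \<open>\<and>\<close> for the determinant of two vectors, \<open>Mv \<and> w + v \<and> Mw = tr M (v \<and>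
  w)\<close>, and both terms on the left vanish.
\<close>

lemma trace_zero_if_swaps:
  fixes M :: "'k::field ^ 2 ^ 2"
  assumes "\<not> parallel v w" "M *v v = a *s w" "M *v w = b *s v"
  shows "trace M = 0"
proof -
  have "trace M * (v$1 * w$2 - v$2 * w$1)
      = ((M *v v)$1 * w$2 - (M *v v)$2 * w$1) + (v$1 * (M *v w)$2 - v$2 * (M *v w)$1)"
    by (simp add: mat2_simps algebra_simps)
  also have "\<dots> = 0" by (simp add: assms)
  finally show ?thesis using assms(1) by (simp add: parallel_def)
qed

lemma finite_image_factor:
  assumes "finite (f ` A)" "\<And>a b. a \<in> A \<Longrightarrow> b \<in> A \<Longrightarrow> f a = f b \<Longrightarrow> g a = g b"
  shows "finite (g ` A)"
proof -
  have "g ` A \<subseteq> (\<lambda>y. g (SOME a. a \<in> A \<and> f a = y)) ` f ` A"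
  proof
    fix y assume "y \<in> g ` A"
    then obtain a where a: "a \<in> A" "y = g a" by blast
    define b where "b = (SOME b. b \<in> A \<and> f b = f a)"
    have "b \<in> A \<and> f b = f a" unfolding b_def by (rule someI[of _ a]) (use a in simp)
    then have "y = g b" using assms(2) a by metis
    then show "y \<in> (\<lambda>y. g (SOME a. a \<in> A \<and> f a = y)) ` f ` A"
      using a unfolding b_def by blast
  qed
  with assms(1) show ?thesis by (meson finite_imageI finite_subset)
qed

lemma (in group) finite_rcosets_if_factor:
  assumes H: "subgroup H G" and "finite (f ` carrier G)"
    and "\<And>a b. a \<in> carrier G \<Longrightarrow> b \<in> carrier G \<Longrightarrow> f a = f b \<Longrightarrow> a \<otimes> inv b \<in> H"
  shows "finite (rcosets H)"
proof -
  have "H #> a = H #> b" if ab: "a \<in> carrier G" "b \<in> carrier G" "f a = f b" for a b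
  proof -
    have "a = (a \<otimes> inv b) \<otimes> b" using ab by (simp add: m_assoc)
    then have "a \<in> H #> b" using assms(3)[OF ab] unfolding r_coset_def by blast
    then show ?thesis using repr_independence[OF _ ab(2) H] by simp
  qed
  with assms(2) have "finite ((\<lambda>a. H #> a) ` carrier G)" by (rule finite_image_factor)
  moreover have "rcosets H = (\<lambda>a. H #> a) ` carrier G" by (auto simp: RCOSETS_def)
  ultimately show ?thesis by simp
qed

lemma not_strongly_irreducible_iff:
  "\<not> strongly_irreducible G \<rho> \<longleftrightarrow>
     (\<exists>H v. subgroup H G \<and> finite (rcosets\<^bsub>G\<^esub> H) \<and> stable_line \<rho> H v)"
  unfolding strongly_irreducible_def
  using not_irreducible_rep_iff[of "G\<lparr>carrier := H\<rparr>" \<rho> for H] by auto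

context two_dim_rep
begin

text \<open>
  The character \<open>\<eta>\<close> is the sign of the permutation of the two lines. It is nontrivial unless both
  lines are stable, and the trace vanishes where \<open>\<eta>\<close> is \<open>-1\<close>.
\<close>

lemma imprimitive_imp_reducible_or_dihedral:
  assumes two: "(2 :: 'k) \<noteq> 0" and np: "\<not> parallel v w"
    and orb: "\<And>g. g \<in> carrier G \<Longrightarrow> parallel v (\<rho> g *v v) \<or> parallel w (\<rho> g *v v)"
      "\<And>g. g \<in> carrier G \<Longrightarrow> parallel v (\<rho> g *v w) \<or> parallel w (\<rho> g *v w)"
  shows "reducible_rep G \<rho> \<or> dihedral_rep G \<rho>"
proof (cases "reducible_rep G \<rho>")
  case False
  have v: "v \<noteq> 0" "w \<noteq> 0" using np by (auto simp: parallel_def)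
  have not_both: "\<not> (parallel x (\<rho> g *v v) \<and> parallel x (\<rho> g *v w))"
    if g: "g \<in> carrier G" and x: "x \<noteq> 0" for x g
  proof
    assume "parallel x (\<rho> g *v v) \<and> parallel x (\<rho> g *v w)"
    then obtain a b where ab: "\<rho> g *v v = a *s x" "\<rho> g *v w = b *s x"
      using parallel_iff[OF x] by blast
    have "\<rho> g *v (b *s v + (- a) *s w) = 0"
      using ab by (simp add: matrix_vector_right_distrib matrix_vector_mult_diff_distrib vec.scale mult.commute)
    then have "b *s v + (- a) *s w = 0" using rep_vec_nonzero[OF g] by blast
    then have e: "b * v$1 = a * w$1" "b * v$2 = a * w$2" by (simp_all add: vec_eq_iff forall_2)
    have "a \<noteq> 0" using ab(1) rep_vec_nonzero[OF g v(1)] by auto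
    have "a * (v$1 * w$2 - v$2 * w$1) = v$1 * (a * w$2) - v$2 * (a * w$1)" by (simp add: algebra_simps)
    also have "\<dots> = 0" by (simp add: e[symmetric])
    finally show False using \<open>a \<noteq> 0\<close> np by (simp add: parallel_def)
  qed
  define fixes_lines where "fixes_lines g \<longleftrightarrow> parallel v (\<rho> g *v v)" for g
  have stays: "\<exists>a b. \<rho> g *v v = a *s v \<and> \<rho> g *v w = b *s w" if "g \<in> carrier G" "fixes_lines g" for g
    using that orb(2)[OF that(1)] not_both[OF that(1) v(1)]
    unfolding fixes_lines_def parallel_iff[OF v(1)] parallel_iff[OF v(2)] by blast
  have swap: "\<exists>a b. \<rho> g *v v = a *s w \<and> \<rho> g *v w = b *s v" if "g \<in> carrier G" "\<not> fixes_lines g" for g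
    using that orb(1,2)[OF that(1)] not_both[OF that(1) v(2)]
    unfolding fixes_lines_def parallel_iff[OF v(1)] parallel_iff[OF v(2)] by blast
  have hom: "fixes_lines (g \<otimes> h) \<longleftrightarrow> (fixes_lines g \<longleftrightarrow> fixes_lines h)"
    if gh: "g \<in> carrier G" "h \<in> carrier G" for g h
  proof -
    have m: "\<rho> (g \<otimes> h) *v v = \<rho> g *v (\<rho> h *v v)" using gh by (simp add: rep_mult matrix_vector_mul_assoc)
    have nz: "\<rho> (g \<otimes> h) *v v \<noteq> 0" using rep_vec_nonzero gh v by blast
    show ?thesis
    proof (cases "fixes_lines h")
      case True
      then obtain a where a: "\<rho> h *v v = a *s v" using stays gh by blast
      with m have m': "\<rho> (g \<otimes> h) *v v = a *s (\<rho> g *v v)" by (simp add: vec.scale)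
      with nz have "a \<noteq> 0" by auto
      with m' True show ?thesis by (simp add: fixes_lines_def parallel_def algebra_simps)
    next
      case False
      then obtain a where a: "\<rho> h *v v = a *s w" using swap gh by blast
      with m have m': "\<rho> (g \<otimes> h) *v v = a *s (\<rho> g *v w)" by (simp add: vec.scale)
      with nz have "a \<noteq> 0" by auto
      with m' have "fixes_lines (g \<otimes> h) \<longleftrightarrow> parallel v (\<rho> g *v w)"
        by (simp add: fixes_lines_def parallel_def algebra_simps)
      also have "\<dots> \<longleftrightarrow> \<not> fixes_lines g"
        using orb[OF gh(1)] not_both[OF gh(1)] v by (auto simp: fixes_lines_def)
      finally show ?thesis using False by simp
    qed
  qed
  define \<eta> :: "'g \<Rightarrow> 'k" where "\<eta> g = (if fixes_lines g then 1 else - 1)" for g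
  have "\<eta> \<in> hom G unit_group"
    unfolding hom_unit_group_iff by (simp add: \<eta>_def hom)
  moreover have "\<exists>g\<in>carrier G. \<eta> g \<noteq> 1"
  proof (rule ccontr)
    assume "\<not> (\<exists>g\<in>carrier G. \<eta> g \<noteq> 1)"
    moreover have "(- 1 :: 'k) \<noteq> 1" using two by (metis add.right_inverse one_add_one)
    ultimately have "fixes_lines g" if "g \<in> carrier G" for g
      using that by (auto simp: \<eta>_def split: if_splits)
    then have "stable_line \<rho> (carrier G) v"
      using stays v(1) unfolding stable_line_def by blast
    with False show False using stable_line_imp_reducible by blast
  qed
  moreover have "\<eta> g * trace (\<rho> g) = trace (\<rho> g) \<and> (\<eta> g)\<^sup>2 * det (\<rho> g) = det (\<rho> g)"
    if "g \<in> carrier G" for g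
    using swap[OF that] trace_zero_if_swaps[OF np] by (auto simp: \<eta>_def)
  ultimately have "dihedral_rep G \<rho>"
    using False unfolding dihedral_rep_def pseudo_dihedral_def reducible_rep_def by blast
  then show ?thesis ..
qed simp

text \<open>
  Otherwise the orbit of the line of \<open>v\<close> has at most two elements, and the group permutes them.
\<close>

lemma orbit_with_three_lines:
  assumes two: "(2 :: 'k) \<noteq> 0" and v: "v \<noteq> 0"
    and "\<not> reducible_rep G \<rho>" "\<not> dihedral_rep G \<rho>"
  obtains g h where "g \<in> carrier G" "h \<in> carrier G" "\<not> parallel v (\<rho> g *v v)"
    "\<not> parallel v (\<rho> h *v v)" "\<not> parallel (\<rho> g *v v) (\<rho> h *v v)"
proof -
  have "\<not> stable_line \<rho> (carrier G) v" using assms(3) stable_line_imp_reducible by blast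
  then obtain g where g: "g \<in> carrier G" "\<not> parallel v (\<rho> g *v v)"
    using v parallel_iff[OF v] by (auto simp: stable_line_def)
  have "\<exists>h\<in>carrier G. \<not> parallel v (\<rho> h *v v) \<and> \<not> parallel (\<rho> g *v v) (\<rho> h *v v)"
  proof (rule ccontr)
    assume "\<not> ?thesis"
    then have orb: "parallel v (\<rho> h *v v) \<or> parallel (\<rho> g *v v) (\<rho> h *v v)" if "h \<in> carrier G" for h
      using that by blast
    moreover have "\<rho> h *v (\<rho> g *v v) = \<rho> (h \<otimes> g) *v v" if "h \<in> carrier G" for h
      using that g(1) by (simp add: rep_mult matrix_vector_mul_assoc)
    ultimately have "parallel v (\<rho> h *v (\<rho> g *v v)) \<or> parallel (\<rho> g *v v) (\<rho> h *v (\<rho> g *v v))"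
      if "h \<in> carrier G" for h
      using that g(1) by simp
    with orb have "reducible_rep G \<rho> \<or> dihedral_rep G \<rho>"
      by (rule imprimitive_imp_reducible_or_dihedral[OF two g(2)])
    with assms(3,4) show False by blast
  qed
  with g that show ?thesis by blast
qed

text \<open>
  The line of \<open>\<rho>(x) v\<close> depends only on the coset \<open>x H\<close>, so the orbit is finite. Take
  three lines of it. If \<open>x\<close> and \<open>y\<close> have the same effect on all three, then \<open>x\<inverse>
  y\<close> fixes them and acts as a scalar, whose square is a value of the determinant. So \<open>\<rho>(y)\<close> is
  determined up to finitely many choices by the effect of \<open>y\<close> on the three lines, for which there are
  finitely many possibilities.
\<close>

lemma finite_index_stable_line:
  assumes two: "(2 :: 'k) \<noteq> 0" and H: "subgroup H G" "finite (rcosets H)" "stable_line \<rho> H v"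
    and fin_det: "finite ((\<lambda>g. det (\<rho> g)) ` carrier G)"
  shows "reducible_rep G \<rho> \<or> dihedral_rep G \<rho> \<or> finite (\<rho> ` carrier G)"
proof (rule ccontr)
  assume neg: "\<not> ?thesis"
  have v: "v \<noteq> 0" using H(3) by (simp add: stable_line_def)
  obtain g h where gh: "g \<in> carrier G" "h \<in> carrier G" "\<not> parallel v (\<rho> g *v v)"
    "\<not> parallel v (\<rho> h *v v)" "\<not> parallel (\<rho> g *v v) (\<rho> h *v v)"
    using orbit_with_three_lines[OF two v] neg by blast
  define line where "line x = {y. parallel (\<rho> x *v v) y}" for x
  have line_eq: "\<exists>c. \<rho> (inv x \<otimes> y) *v v = c *s v"
    if xy: "x \<in> carrier G" "y \<in> carrier G" "line x = line y" for x y
  proof -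
    have "\<rho> y *v v \<in> line x" using xy(3) by (simp add: line_def parallel_def mult.commute)
    then obtain c where c: "\<rho> y *v v = c *s (\<rho> x *v v)"
      using parallel_iff[OF rep_vec_nonzero[OF xy(1) v]] by (auto simp: line_def)
    have "\<rho> (inv x \<otimes> y) *v v = \<rho> (inv x) *v (\<rho> y *v v)"
      using xy by (simp add: rep_mult matrix_vector_mul_assoc)
    also have "\<dots> = c *s ((\<rho> (inv x) ** \<rho> x) *v v)" by (simp add: c vec.scale matrix_vector_mul_assoc)
    finally show ?thesis using xy by (auto simp: rep_inv_left)
  qed
  have fin_line: "finite (line ` carrier G)"
  proof (rule finite_image_factor)
    \<comment> \<open>Right cosets of inverses stand for left cosets.\<close>
    have "(\<lambda>a. H #> inv a) ` carrier G \<subseteq> rcosets H" by (auto simp: RCOSETS_def)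
    with H(2) show "finite ((\<lambda>a. H #> inv a) ` carrier G)" by (rule finite_subset[rotated])
  next
    fix x y assume xy: "x \<in> carrier G" "y \<in> carrier G" "H #> inv x = H #> inv y"
    have "inv x \<in> H #> inv y" using xy rcos_self[OF _ H(1), of "inv x"] by simp
    then obtain k where k: "k \<in> H" "inv x = k \<otimes> inv y" unfolding r_coset_def by blast
    have kG: "k \<in> carrier G" using k(1) H(1) subgroup.mem_carrier by metis
    have "x \<otimes> k = x \<otimes> (inv x \<otimes> y)" using k(2) xy kG by (simp add: m_assoc)
    then have y: "y = x \<otimes> k" using xy by (simp flip: m_assoc)
    obtain c where c: "\<rho> k *v v = c *s v" using H(3) k(1) by (auto simp: stable_line_def)
    have "c \<noteq> 0" using rep_vec_nonzero[OF kG v] c by auto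
    have "\<rho> y *v v = \<rho> x *v (\<rho> k *v v)" using xy kG by (simp add: y rep_mult matrix_vector_mul_assoc)
    also have "\<dots> = c *s (\<rho> x *v v)" by (simp add: c vec.scale)
    finally show "line x = line y"
      using \<open>c \<noteq> 0\<close> by (auto simp: line_def parallel_def)
  qed
  define D where "D = (\<lambda>g. det (\<rho> g)) ` carrier G"
  define C where "C = {c. c\<^sup>2 \<in> D}"
  have "finite C"
  proof -
    have "finite {c :: 'k. c\<^sup>2 = d}" for d
    proof (cases "\<exists>r. r\<^sup>2 = d")
      case True
      then obtain r where r: "r\<^sup>2 = d" by blast
      have "{c. c\<^sup>2 = d} \<subseteq> {r, - r}" using r by (auto simp: power2_eq_iff)
      then show ?thesis by (rule finite_subset) simp
    qed (simp add: not_ex)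
    then have "finite (\<Union>d\<in>D. {c. c\<^sup>2 = d})" using fin_det unfolding D_def by (rule finite_UN_I[rotated])
    moreover have "C = (\<Union>d\<in>D. {c. c\<^sup>2 = d})" by (auto simp: C_def)
    ultimately show ?thesis by simp
  qed
  define lines where "lines x = (line x, line (x \<otimes> g), line (x \<otimes> h))" for x
  have "lines ` carrier G \<subseteq> line ` carrier G \<times> line ` carrier G \<times> line ` carrier G"
    using gh(1,2) by (auto simp: lines_def)
  then have fin_lines: "finite (lines ` carrier G)"
    by (rule finite_subset) (simp add: fin_line)
  have scalar: "\<exists>c\<in>C. \<rho> y = \<rho> x ** mat c"
    if xy: "x \<in> carrier G" "y \<in> carrier G" "lines x = lines y" for x y
  proof -
    define M where "M = \<rho> (inv x \<otimes> y)"
    have e: "\<exists>c. M *v (\<rho> k *v v) = c *s (\<rho> k *v v)" if k: "k \<in> carrier G" "line (x \<otimes> k) = line (y \<otimes> k)" for k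
    proof -
      obtain c where c: "\<rho> (inv (x \<otimes> k) \<otimes> (y \<otimes> k)) *v v = c *s v"
        using line_eq[of "x \<otimes> k" "y \<otimes> k"] k xy by auto
      have "k \<otimes> (inv k \<otimes> (inv x \<otimes> (y \<otimes> k))) = inv x \<otimes> (y \<otimes> k)"
        using xy k by (simp add: m_assoc[symmetric, of k "inv k"])
      then have eq: "k \<otimes> (inv (x \<otimes> k) \<otimes> (y \<otimes> k)) = inv x \<otimes> y \<otimes> k"
        using xy k by (simp add: inv_mult_group m_assoc)
      have "M *v (\<rho> k *v v) = \<rho> (inv x \<otimes> y \<otimes> k) *v v"
        using xy k by (simp add: M_def rep_mult matrix_vector_mul_assoc)
      also have "\<dots> = \<rho> k *v (\<rho> (inv (x \<otimes> k) \<otimes> (y \<otimes> k)) *v v)"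
        using xy k by (simp add: matrix_vector_mul_assoc flip: rep_mult eq)
      finally show ?thesis by (auto simp: c vec.scale)
    qed
    have "\<exists>c. M *v v = c *s v" using line_eq[OF xy(1,2)] xy(3) by (simp add: lines_def M_def)
    then obtain c where c: "M *v v = c *s v" ..
    have "line (x \<otimes> g) = line (y \<otimes> g)" "line (x \<otimes> h) = line (y \<otimes> h)"
      using xy(3) by (simp_all add: lines_def)
    then obtain c2 c3 where "M *v (\<rho> g *v v) = c2 *s (\<rho> g *v v)" "M *v (\<rho> h *v v) = c3 *s (\<rho> h *v v)"
      using e gh(1,2) by metis
    with c have M: "M = mat c" by (rule three_eigenvectors_scalar[OF gh(3-5)])
    have "c\<^sup>2 = det M" by (simp add: M det_2 mat_def power2_eq_square)
    then have "c \<in> C" using xy by (auto simp: C_def D_def M_def)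
    moreover have "\<rho> y = \<rho> (x \<otimes> (inv x \<otimes> y))" using xy by (simp flip: m_assoc)
    then have "\<rho> y = \<rho> x ** M" using xy by (simp add: M_def rep_mult del: m_assoc)
    ultimately show ?thesis using M by blast
  qed
  define rep where "rep = inv_into (carrier G) lines"
  have "\<rho> ` carrier G \<subseteq> (\<lambda>(l, c). \<rho> (rep l) ** mat c) ` (lines ` carrier G \<times> C)"
  proof
    fix M assume "M \<in> \<rho> ` carrier G"
    then obtain y where y: "y \<in> carrier G" "M = \<rho> y" by blast
    have "rep (lines y) \<in> carrier G" "lines (rep (lines y)) = lines y"
      using y(1) by (simp_all add: rep_def inv_into_into f_inv_into_f)
    then obtain c where "c \<in> C" "\<rho> y = \<rho> (rep (lines y)) ** mat c" using scalar y(1) by blast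
    with y show "M \<in> (\<lambda>(l, c). \<rho> (rep l) ** mat c) ` (lines ` carrier G \<times> C)" by force
  qed
  then have "finite (\<rho> ` carrier G)"
    using fin_lines \<open>finite C\<close> by (meson finite_SigmaI finite_imageI finite_subset)
  with neg show False by blast
qed

end

text \<open>
  The character \<open>\<eta>\<close> has order two and the trace vanishes off its kernel \<open>H\<close>. For
  \<open>g\<close> outside \<open>H\<close> and \<open>h\<close>, \<open>k\<close> in \<open>H\<close>, the products
  \<open>g h\<close>, \<open>g k\<close> and \<open>g h k\<close> lie outside \<open>H\<close>, so
  \<open>commute_if_traces_vanish\<close> shows that \<open>\<rho>(H)\<close> is commutative.
\<close>

lemma dihedral_imp_finite_index_stable_line:
  fixes G (structure) and \<rho> :: "'g \<Rightarrow> 'k::alg_closed_field ^ 2 ^ 2"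
  assumes "two_dim_rep G \<rho>" and dih: "dihedral_rep G \<rho>"
  shows "\<exists>H v. subgroup H G \<and> finite (rcosets\<^bsub>G\<^esub> H) \<and> stable_line \<rho> H v"
proof -
  interpret two_dim_rep G \<rho> by fact
  obtain \<eta> where \<eta>: "\<eta> \<in> hom G unit_group" and nontriv: "\<exists>g\<in>carrier G. \<eta> g \<noteq> 1"
    and twist: "\<And>g. g \<in> carrier G \<Longrightarrow> \<eta> g * trace (\<rho> g) = trace (\<rho> g)"
      "\<And>g. g \<in> carrier G \<Longrightarrow> (\<eta> g)\<^sup>2 * det (\<rho> g) = det (\<rho> g)"
    using dih unfolding dihedral_rep_def pseudo_dihedral_def by blast
  have mult: "\<eta> (g \<otimes> h) = \<eta> g * \<eta> h" if "g \<in> carrier G" "h \<in> carrier G" for g h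
    using \<eta> that by (simp add: hom_unit_group_iff)
  have sq: "(\<eta> g)\<^sup>2 = 1" if "g \<in> carrier G" for g
    using twist(2)[OF that] rep_det_nonzero[OF that] by simp
  have tr0: "trace (\<rho> g) = 0" if "g \<in> carrier G" "\<eta> g \<noteq> 1" for g
    using twist(1)[OF that(1)] that(2) by simp
  obtain g where g: "g \<in> carrier G" "\<eta> g \<noteq> 1" using nontriv by blast
  define H where "H = {h \<in> carrier G. \<eta> h = 1}"
  have one: "\<eta> \<one> = 1" using mult[of \<one> \<one>] sq[of \<one>] by (auto simp: power2_eq_square)
  have inv_val: "\<eta> (inv h) = \<eta> h" if "h \<in> carrier G" for h
  proof -
    have "\<eta> (inv h) * \<eta> h = 1" using mult[of "inv h" h] that one by simp
    moreover have "\<eta> h * \<eta> h = 1" using sq[OF that] by (simp add: power2_eq_square)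
    ultimately show ?thesis by (metis mult.assoc mult_1_left mult_1_right)
  qed
  have "subgroup H G"
    by (rule subgroupI) (auto simp: H_def mult inv_val one intro: exI[of _ \<one>])
  moreover have "finite (rcosets H)"
  proof (rule finite_rcosets_if_factor[OF \<open>subgroup H G\<close>])
    have "\<eta> ` carrier G \<subseteq> {1, - 1}" using sq by (auto simp: power2_eq_1_iff)
    then show "finite (\<eta> ` carrier G)" by (rule finite_subset) simp
    show "a \<otimes> inv b \<in> H" if "a \<in> carrier G" "b \<in> carrier G" "\<eta> a = \<eta> b" for a b
      using that sq[of b] by (simp add: H_def mult inv_val power2_eq_square)
  qed
  moreover have "\<rho> h ** \<rho> k = \<rho> k ** \<rho> h" if "h \<in> H" "k \<in> H" for h k
  proof (rule commute_if_traces_vanish)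
    have hk: "h \<in> carrier G" "k \<in> carrier G" "\<eta> h = 1" "\<eta> k = 1" using that by (auto simp: H_def)
    show "det (\<rho> g) \<noteq> 0" "trace (\<rho> g) = 0" using g by (simp_all add: rep_det_nonzero tr0)
    show "trace (\<rho> g ** \<rho> h) = 0" "trace (\<rho> g ** \<rho> k) = 0" "trace (\<rho> g ** (\<rho> h ** \<rho> k)) = 0"
      using g hk by (simp_all add: tr0 mult flip: rep_mult)
  qed
  then have "\<exists>v. stable_line \<rho> H v" by (rule commuting_stable_line)
  ultimately show ?thesis by blast
qed

proposition not_strongly_irreducible_iff_reducible_dihedral_finite:
  fixes G (structure) and \<rho> :: "'g \<Rightarrow> 'k::alg_closed_field ^ 2 ^ 2"
  assumes "two_dim_rep G \<rho>" and two: "(2 :: 'k) \<noteq> 0"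
    and fin: "finite ((\<lambda>g. det (\<rho> g)) ` carrier G)"
  shows "\<not> strongly_irreducible G \<rho> \<longleftrightarrow>
    reducible_rep G \<rho> \<or> dihedral_rep G \<rho> \<or> finite (\<rho> ` carrier G)"
proof -
  interpret two_dim_rep G \<rho> by fact
  have whole: "finite (rcosets (carrier G))"
    by (rule finite_rcosets_if_factor[OF subgroup_self, of "\<lambda>_. ()"]) auto
  show ?thesis
  proof
    assume "\<not> strongly_irreducible G \<rho>"
    then show "reducible_rep G \<rho> \<or> dihedral_rep G \<rho> \<or> finite (\<rho> ` carrier G)"
      unfolding not_strongly_irreducible_iff using finite_index_stable_line[OF two _ _ _ fin] by metis
  next
    assume "reducible_rep G \<rho> \<or> dihedral_rep G \<rho> \<or> finite (\<rho> ` carrier G)"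
    then consider "reducible_rep G \<rho>" | "dihedral_rep G \<rho>" | "finite (\<rho> ` carrier G)" by blast
    then show "\<not> strongly_irreducible G \<rho>"
    proof cases
      case 1
      then show ?thesis
        unfolding not_strongly_irreducible_iff
        using reducible_imp_stable_line[OF two] subgroup_self whole by metis
    next
      case 2
      then show ?thesis
        unfolding not_strongly_irreducible_iff
        by (rule dihedral_imp_finite_index_stable_line[OF assms(1)])
    next
      case 3
      define H where "H = {h \<in> carrier G. \<rho> h = mat 1}"
      have inv_one: "\<rho> (inv h) = mat 1" if "h \<in> carrier G" "\<rho> h = mat 1" for h
        using rep_inv_right[OF that(1)] that(2) by simp
      have "subgroup H G"
        by (rule subgroupI) (auto simp: H_def rep_mult rep_one inv_one intro: exI[of _ \<one>])
      moreover have "finite (rcosets H)"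
        by (rule finite_rcosets_if_factor[OF \<open>subgroup H G\<close> 3])
          (simp add: H_def rep_mult rep_inv_right)
      moreover have "\<rho> h *v axis 1 1 = 1 *s axis 1 1" if "h \<in> H" for h
        using that by (simp add: H_def)
      then have "stable_line \<rho> H (axis 1 1)"
        unfolding stable_line_def by (metis axis_eq_0_iff zero_neq_one)
      ultimately show ?thesis unfolding not_strongly_irreducible_iff by blast
    qed
  qed
qed

section \<open>Normal p-subgroups of the image\<close>

text \<open>
  The class equation: a conjugacy class of a noncentral element has a number of elements divisible by \<open>p\<close>.
  If only \<open>1\<close> were central, the order of the group would be congruent to 1.
\<close>

lemma (in group) p_group_center_nontrivial:
  assumes p: "Factorial_Ring.prime (p :: nat)" and ord: "order G = p ^ k" and fin: "finite (carrier G)"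
    and nontriv: "carrier G \<noteq> {\<one>}"
  shows "\<exists>z\<in>carrier G. z \<noteq> \<one> \<and> (\<forall>x\<in>carrier G. x \<otimes> z = z \<otimes> x)"
proof (rule ccontr)
  assume "\<not> ?thesis"
  then have central: "z = \<one>" if "z \<in> carrier G" "\<And>x. x \<in> carrier G \<Longrightarrow> x \<otimes> z = z \<otimes> x" for z
    using that by blast
  define \<phi> where "\<phi> = (\<lambda>g. \<lambda>h \<in> carrier G. g \<otimes> h \<otimes> inv g)"
  interpret conj: group_action G "carrier G" \<phi>
    unfolding \<phi>_def by (rule action_by_conjugation)
  have orb: "orbit G \<phi> x = {g \<otimes> x \<otimes> inv g | g. g \<in> carrier G}" if "x \<in> carrier G" for x
    using that by (auto simp: orbit_def \<phi>_def)
  have fin_orb: "finite (orbits G (carrier G) \<phi>)"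
    using fin by (simp add: orbits_def setcompr_eq_image)
  have orb_one: "orbit G \<phi> \<one> = {\<one>}"
    unfolding orb[OF one_closed] by (auto intro: exI[of _ \<one>])
  have "{\<one>} \<in> orbits G (carrier G) \<phi>"
    unfolding orbits_def using orb_one one_closed by blast
  have dvd: "p dvd card B" if B: "B \<in> orbits G (carrier G) \<phi> - {{\<one>}}" for B
  proof -
    obtain x where x: "x \<in> carrier G" "B = orbit G \<phi> x" using B by (auto simp: orbits_def)
    have "card B dvd p ^ k"
      using conj.orbit_stabilizer_theorem[OF x(1)] ord x(2) by (metis dvd_triv_left)
    then obtain j where j: "card B = p ^ j" using p by (auto simp: divides_primepow_nat)
    have "j \<noteq> 0"
    proof
      assume "j = 0"
      then obtain y where "B = {y}" using j by (auto simp: card_1_singleton_iff)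
      moreover have "x = \<one> \<otimes> x \<otimes> inv \<one>" using x(1) by simp
      then have "x \<in> B" unfolding x(2) orb[OF x(1)] using one_closed by blast
      ultimately have "B = {x}" by simp
      have "g \<otimes> x = x \<otimes> g" if g: "g \<in> carrier G" for g
      proof -
        have "g \<otimes> x \<otimes> inv g \<in> B" unfolding x(2) orb[OF x(1)] using g by blast
        then have "g \<otimes> x \<otimes> inv g = x" using \<open>B = {x}\<close> by simp
        then show ?thesis using g x(1) by (metis inv_solve_right' m_closed)
      qed
      then have "x = \<one>" using central[OF x(1)] by blast
      with \<open>B = {x}\<close> B show False by simp
    qed
    then show ?thesis by (simp add: j)
  qed
  have "order G = (\<Sum>B\<in>orbits G (carrier G) \<phi>. card B)"
    using conj.disjoint_sum[OF fin, of "\<lambda>_. 1 :: nat"] by (simp add: order_def)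
  also have "\<dots> = card {\<one>} + (\<Sum>B\<in>orbits G (carrier G) \<phi> - {{\<one>}}. card B)"
    by (rule sum.remove[OF fin_orb]) fact
  finally have sum: "order G = 1 + (\<Sum>B\<in>orbits G (carrier G) \<phi> - {{\<one>}}. card B)" by simp
  have "order G \<noteq> 1"
    using nontriv one_closed by (metis card_1_singleton_iff order_def One_nat_def singletonD)
  then have "p dvd order G" using ord by (cases k) auto
  moreover have "p dvd (\<Sum>B\<in>orbits G (carrier G) \<phi> - {{\<one>}}. card B)"
    by (rule dvd_sum) (rule dvd)
  ultimately have "p dvd 1" using sum by (metis dvd_add_left_iff)
  with p show False by auto
qed

text \<open>
  A prime other than \<open>p\<close> that divides the order would, by Sylow's theorem, give a nontrivial element of
  order prime to \<open>p\<close>.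
\<close>

lemma (in group) order_prime_power:
  assumes p: "Factorial_Ring.prime (p :: nat)" and fin: "finite (carrier G)"
    and tors: "\<And>x n. x \<in> carrier G \<Longrightarrow> coprime n p \<Longrightarrow> x [^] n = \<one> \<Longrightarrow> x = \<one>"
  shows "\<exists>k. order G = p ^ k"
proof -
  have pos: "order G > 0" using fin order_gt_0_iff_finite by blast
  have only_p: "q = p" if q: "Factorial_Ring.prime q" "q dvd order G" for q :: nat
  proof (rule ccontr)
    assume "q \<noteq> p"
    define a where "a = multiplicity q (order G)"
    have "a > 0" using q pos by (simp add: a_def prime_multiplicity_gt_zero_iff)
    have "q ^ a dvd order G" unfolding a_def by (rule multiplicity_dvd)
    then obtain m where "order G = q ^ a * m" by (elim dvdE)
    then obtain S where S: "subgroup S G" "card S = q ^ a"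
      using sylow_thm[OF q(1) is_group _ fin] by blast
    interpret S: group "G\<lparr>carrier := S\<rparr>" using subgroup_imp_group[OF S(1)] .
    have "q ^ a > 1" by (rule one_less_power[OF prime_gt_1_nat[OF q(1)] \<open>a > 0\<close>])
    then have "S \<noteq> {\<one>}" using S(2) by auto
    then obtain x where x: "x \<in> S" "x \<noteq> \<one>" using subgroup.one_closed[OF S(1)] by blast
    have "x [^]\<^bsub>G\<lparr>carrier := S\<rparr>\<^esub> (q ^ a) = \<one>"
      using S.pow_order_eq_1[of x] x(1) S(2) by (simp add: order_def)
    then have "x [^] (q ^ a) = \<one>" by (simp add: nat_pow_consistent[symmetric])
    moreover have "coprime (q ^ a) p" using primes_coprime[OF q(1) p \<open>q \<noteq> p\<close>] by simp
    ultimately show False using tors x subgroup.mem_carrier[OF S(1)] by blast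
  qed
  have "p ^ multiplicity p (order G) dvd order G" by (rule multiplicity_dvd)
  then obtain m where m: "order G = p ^ multiplicity p (order G) * m" by (elim dvdE)
  have "\<not> p dvd m"
  proof
    assume "p dvd m"
    then have "p ^ Suc (multiplicity p (order G)) dvd order G"
      using m by (metis dvd_refl mult_dvd_mono power_Suc2)
    moreover have "\<not> is_unit p" using p by auto
    ultimately show False using pos not_dvd_imp_multiplicity_0 multiplicity_geI[of "order G" p "Suc (multiplicity p (order G))"] by simp
  qed
  have "m = 1"
  proof (rule ccontr)
    assume "m \<noteq> 1"
    then obtain q where "Factorial_Ring.prime q" "q dvd m" using prime_factor_nat by blast
    with only_p m \<open>\<not> p dvd m\<close> show False by (metis dvd_mult)
  qed
  with m show ?thesis by auto
qed

text \<open>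
  A central element \<open>z\<close> of the finite \<open>p\<close>-group \<open>\<rho>(N)\<close> commutes with all its
  conjugates under the whole group, so that every line in the orbit of an eigenline of \<open>z\<close> is again an
  eigenline. An orbit with three lines would make \<open>z\<close> a scalar; but a scalar of determinant 1 has square 1,
  and \<open>p\<close> is odd.
\<close>

lemma normal_p_subgroup_trivial:
  fixes G (structure) and \<rho> :: "'g \<Rightarrow> 'k::alg_closed_field ^ 2 ^ 2"
  assumes "two_dim_rep G \<rho>" and two: "(2 :: 'k) \<noteq> 0" and p: "Factorial_Ring.prime p" "odd p"
    and N: "N \<lhd> G" and fin: "finite (\<rho> ` N)"
    and det: "\<And>g. g \<in> N \<Longrightarrow> det (\<rho> g) = 1"
    and tors: "\<And>g n. g \<in> N \<Longrightarrow> coprime n p \<Longrightarrow> \<rho> (g [^]\<^bsub>G\<^esub> (n :: nat)) = mat 1 \<Longrightarrow> \<rho> g = mat 1"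
    and irr: "\<not> reducible_rep G \<rho>" "\<not> dihedral_rep G \<rho>"
    and g: "g \<in> N"
  shows "\<rho> g = mat 1"
proof (rule ccontr)
  assume g1: "\<rho> g \<noteq> mat 1"
  interpret two_dim_rep G \<rho> by fact
  interpret N: normal N G by fact
  interpret GL: group "GL :: ('k ^ 2 ^ 2) monoid" by (rule group_GL)
  interpret hom: group_hom G "GL :: ('k ^ 2 ^ 2) monoid" \<rho> by (rule rep_group_hom)
  define P where "P = (GL :: ('k ^ 2 ^ 2) monoid)\<lparr>carrier := \<rho> ` N\<rparr>"
  have "subgroup (\<rho> ` N) GL" by (rule hom.subgroup_img_is_subgroup[OF N.subgroup_axioms])
  then interpret P: group P unfolding P_def by (rule GL.subgroup_imp_group)
  have P_simps: "carrier P = \<rho> ` N" "\<one>\<^bsub>P\<^esub> = mat 1" "x \<otimes>\<^bsub>P\<^esub> y = x ** y" for x y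
    by (simp_all add: P_def GL_def)
  have P_pow: "x [^]\<^bsub>P\<^esub> (n :: nat) = x [^]\<^bsub>GL\<^esub> n" for x n
    by (simp add: P_def GL.nat_pow_consistent[symmetric])
  have "x = \<one>\<^bsub>P\<^esub>" if "x \<in> carrier P" "coprime n p" "x [^]\<^bsub>P\<^esub> n = \<one>\<^bsub>P\<^esub>" for x and n :: nat
    using that tors by (auto simp: P_simps P_pow hom.hom_nat_pow)
  then obtain k where k: "order P = p ^ k"
    using P.order_prime_power[OF p(1)] fin by (auto simp: P_simps)
  have "carrier P \<noteq> {\<one>\<^bsub>P\<^esub>}" using g g1 by (auto simp: P_simps)
  then have "\<exists>z\<in>\<rho> ` N. z \<noteq> mat 1 \<and> (\<forall>x\<in>\<rho> ` N. x ** z = z ** x)"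
    using P.p_group_center_nontrivial[OF p(1) k] fin unfolding P_simps by blast
  then obtain z where z: "z \<in> \<rho> ` N" "z \<noteq> mat 1" "\<And>x. x \<in> \<rho> ` N \<Longrightarrow> x ** z = z ** x"
    by metis
  obtain n where n: "n \<in> N" "z = \<rho> n" using z(1) by blast
  have nonscalar: "z \<noteq> mat c" for c
  proof
    assume c: "z = mat c"
    have "c\<^sup>2 = 1" using det[OF n(1)] by (simp add: n(2)[symmetric] c det_2 mat_def power2_eq_square)
    then have "z ** z = mat 1" by (simp add: c mat2_simps power2_eq_square)
    then have "\<rho> (n [^] (2::nat)) = mat 1"
      using n by (simp add: numeral_2_eq_2 GL_def)
    moreover have "coprime 2 p" using p(2) by simp
    ultimately show False using tors[OF n(1)] z(2) n(2) by blast
  qed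
  obtain c v where v: "v \<noteq> 0" "z *v v = c *s v" by (rule eigenvector_exists)
  have eig: "\<exists>a. z *v (\<rho> x *v v) = a *s (\<rho> x *v v)" if x: "x \<in> carrier G" for x
  proof -
    have nG: "n \<in> carrier G" using n(1) by (rule N.mem_carrier)
    have "inv x \<otimes> n \<otimes> x \<in> N" using N.inv_op_closed1[OF x n(1)] .
    then have "\<rho> (inv x \<otimes> n \<otimes> x) ** z = z ** \<rho> (inv x \<otimes> n \<otimes> x)" using z(3) by blast
    then obtain a where a: "\<rho> (inv x \<otimes> n \<otimes> x) *v v = a *s v"
      using commuting_matrix_eigenvector[OF nonscalar v] by blast
    have "n \<otimes> x = x \<otimes> (inv x \<otimes> n \<otimes> x)" using x nG by (simp add: m_assoc[symmetric])
    then have "z *v (\<rho> x *v v) = \<rho> x *v (\<rho> (inv x \<otimes> n \<otimes> x) *v v)"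
      using x nG unfolding n(2) matrix_vector_mul_assoc by (metis inv_closed m_closed rep_mult)
    then show ?thesis by (auto simp: a vec.scale)
  qed
  obtain x y where xy: "x \<in> carrier G" "y \<in> carrier G" "\<not> parallel v (\<rho> x *v v)"
    "\<not> parallel v (\<rho> y *v v)" "\<not> parallel (\<rho> x *v v) (\<rho> y *v v)"
    using orbit_with_three_lines[OF two v(1) irr] by metis
  obtain a b where "z *v (\<rho> x *v v) = a *s (\<rho> x *v v)" "z *v (\<rho> y *v v) = b *s (\<rho> y *v v)"
    using eig xy(1,2) by metis
  with v(2) have "z = mat c" by (rule three_eigenvectors_scalar[OF xy(3-5)])
  with nonscalar show False by blast
qed

lemma cayley_hamilton_2:
  fixes M :: "'k::field ^ 2 ^ 2"
  shows "M ** M = mat (trace M) ** M - mat (det M)"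
  by (simp add: mat2_simps algebra_simps)

text \<open>
  Reduction modulo the maximal ideal does not apply to the matrix \<open>\<rho>(g)\<close> itself, whose entries need
  not be integral, but it does apply to the ring generated by \<open>\<rho>(g)\<close> over the local ring. Put \<open>N
  = \<rho>(g) - 1\<close>; Cayley-Hamilton gives \<open>N\<^sup>2 = e (N + 1)\<close>, so \<open>N\<close> is nilpotent
  modulo \<open>e\<close>. Now \<open>\<rho>(g)\<^sup>n - 1 = N U\<close>, where \<open>U\<close> is congruent to
  \<open>n\<close> modulo \<open>N\<close> and \<open>e\<close>. Therefore \<open>det U\<close> is congruent to the unit
  \<open>n\<^sup>2\<close> modulo \<open>e\<close>, \<open>U\<close> is invertible, and \<open>N U = 0\<close> forces
  \<open>N = 0\<close>.
\<close>

lemma (in two_dim_rep) one_if_power_one: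
  fixes f :: "'a::local_ring \<Rightarrow> 'k"
  assumes f: "\<And>x y. f (x + y) = f x + f y" "\<And>x y. f (x * y) = f x * f y" "f 1 = 1"
    and g: "g \<in> carrier G" "det (\<rho> g) = 1" "trace (\<rho> g) = f (2 + e)"
    and e: "\<not> e dvd 1" and n: "of_nat n dvd (1 :: 'a)"
    and pow: "\<rho> (g [^] n) = mat 1"
  shows "\<rho> g = mat 1"
proof -
  define N where "N = \<rho> g - mat 1"
  have f2: "f (2 + e) = 2 + f e" using f by (metis one_add_one)
  have trN: "trace N = f e" using g(3) f2 by (simp add: N_def trace_sub trace_I)
  have "det N = det (\<rho> g) - trace (\<rho> g) + 1" by (simp add: N_def mat2_simps algebra_simps)
  then have detN: "det N = - f e" using g f2 by simp
  have NN: "N ** N = mat (f e) ** N + mat (f e)"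
    unfolding cayley_hamilton_2[of N] trN detN by (simp add: mat2_simps)
  define U where "U a b = mat (f a) + mat (f b) ** N" for a b
  have step: "mat 1 + U a b + N ** U a b = U (1 + a + b * e) (a + b + b * e)" for a b
  proof -
    have "N ** U a b = mat (f a) ** N + mat (f b) ** (N ** N)"
      by (simp add: U_def mat2_simps algebra_simps)
    then show ?thesis unfolding NN by (simp add: U_def f mat2_simps algebra_simps)
  qed
  have "\<exists>a b. \<rho> (g [^] m) = mat 1 + N ** U (of_nat m + e * a) b" for m
  proof (induction m)
    case 0
    have "f 0 + f 0 = f 0 + 0" using f(1)[of 0 0] by (simp only: add_0_left add_0_right)
    then have f0: "f 0 = 0" by (rule add_left_imp_eq)
    have "\<rho> (g [^] (0::nat)) = mat 1 + N ** U (of_nat 0 + e * 0) 0"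
      by (simp add: rep_one U_def f0 mat2_simps)
    then show ?case by blast
  next
    case (Suc m)
    then obtain a b where ab: "\<rho> (g [^] m) = mat 1 + N ** U (of_nat m + e * a) b" by blast
    define V where "V = U (of_nat m + e * a) b"
    have "\<rho> (g [^] Suc m) = \<rho> (g [^] m) ** \<rho> g" using g(1) by (simp add: rep_mult)
    also have "\<dots> = (mat 1 + N ** V) ** (mat 1 + N)" by (simp add: ab V_def N_def)
    also have "\<dots> = mat 1 + N ** (mat 1 + V + V ** N)"
      by (simp add: mat2_simps algebra_simps)
    also have "V ** N = N ** V" by (simp add: V_def U_def mat2_simps algebra_simps)
    also have "mat 1 + V + N ** V = U (1 + (of_nat m + e * a) + b * e) (of_nat m + e * a + b + b * e)"
      unfolding V_def by (rule step)
    also have "1 + (of_nat m + e * a) + b * e = of_nat (Suc m) + e * (a + b)" by (simp add: algebra_simps)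
    finally show ?case by blast
  qed
  then obtain a b where ab: "\<rho> (g [^] n) = mat 1 + N ** U (of_nat n + e * a) b" by blast
  define \<alpha> where "\<alpha> = of_nat n + e * a"
  have NU: "N ** U \<alpha> b = 0" using ab pow by (simp add: \<alpha>_def)
  have unit: "(\<alpha>\<^sup>2 + \<alpha> * b * e - b\<^sup>2 * e) dvd 1"
  proof (rule nonunit_diff_cong_unit)
    show "((of_nat n)\<^sup>2 :: 'a) dvd 1" using mult_dvd_mono[OF n n] by (simp add: power2_eq_square)
    have "(of_nat n)\<^sup>2 - (\<alpha>\<^sup>2 + \<alpha> * b * e - b\<^sup>2 * e)
        = e * (b\<^sup>2 - \<alpha> * b - 2 * of_nat n * a - e * a\<^sup>2)"
      by (simp add: \<alpha>_def power2_eq_square algebra_simps)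
    then show "\<not> ((of_nat n)\<^sup>2 - (\<alpha>\<^sup>2 + \<alpha> * b * e - b\<^sup>2 * e)) dvd 1"
      using nonunit_mult[OF e] by simp
  qed
  then obtain u where u: "1 = (\<alpha>\<^sup>2 + \<alpha> * b * e - b\<^sup>2 * e) * u" by (elim dvdE)
  have "f (\<alpha>\<^sup>2 + \<alpha> * b * e - b\<^sup>2 * e) = det (U \<alpha> b)"
  proof -
    have f_diff: "f (x - y) = f x - f y" for x y using f(1)[of "x - y" y] by simp
    have "det (U \<alpha> b) = (f \<alpha>)\<^sup>2 + f \<alpha> * f b * trace N + (f b)\<^sup>2 * det N"
      by (simp add: U_def mat2_simps power2_eq_square algebra_simps)
    then show ?thesis by (simp add: trN detN f f_diff power2_eq_square)
  qed
  moreover have "f (\<alpha>\<^sup>2 + \<alpha> * b * e - b\<^sup>2 * e) * f u = 1" using u f by metis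
  ultimately have "det (U \<alpha> b) \<noteq> 0" by auto
  then obtain V where "U \<alpha> b ** V = mat 1" by (metis invertible_def invertible_det_nz)
  then have "N = N ** U \<alpha> b ** V" by (simp flip: matrix_mul_assoc)
  then have "N = 0" by (simp add: NU)
  then show ?thesis by (simp add: N_def)
qed

section \<open>Twisting by scalars\<close>

lemma pseudo_reducible_cong:
  assumes "\<And>g. g \<in> carrier G \<Longrightarrow> t g = t' g"
  shows "pseudo_reducible G t \<longleftrightarrow> pseudo_reducible G t'"
  using assms by (simp add: pseudo_reducible_def)

lemma pseudo_dihedral_cong:
  assumes "\<And>g. g \<in> carrier G \<Longrightarrow> t g = t' g" "\<And>g. g \<in> carrier G \<Longrightarrow> d g = d' g"
  shows "pseudo_dihedral G t d \<longleftrightarrow> pseudo_dihedral G t' d'"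
  using assms by (simp add: pseudo_dihedral_def pseudo_reducible_cong[of G t t'])

lemma pseudo_kernel_cong:
  assumes "group G" "\<And>g. g \<in> carrier G \<Longrightarrow> t g = t' g" "\<And>g. g \<in> carrier G \<Longrightarrow> d g = d' g"
  shows "pseudo_kernel G t d = pseudo_kernel G t' d'"
proof -
  interpret group G by fact
  show ?thesis using assms(2,3) by (auto simp: pseudo_kernel_def)
qed

lemma pseudo_kernel_inj:
  assumes "inj f" "f 1 = 1"
  shows "pseudo_kernel G (\<lambda>g. f (t g)) (\<lambda>g. f (d g)) = pseudo_kernel G t d"
  using assms by (auto simp: pseudo_kernel_def inj_eq) (metis inj_eq)+

lemma mat_mult_vec: "(mat c ** M) *v v = c *s (M *v v)" for M :: "'k::field ^ 2 ^ 2"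
  by (simp add: mat2_simps algebra_simps)

lemma trace_mat_mult: "trace (mat c ** M) = c * trace M" for M :: "'k::field ^ 2 ^ 2"
  by (simp add: mat2_simps algebra_simps)

lemma det_mat_mult: "det (mat c ** M) = c\<^sup>2 * det M" for M :: "'k::field ^ 2 ^ 2"
  by (simp add: mat2_simps power2_eq_square algebra_simps)

lemma stable_line_scalar_twist:
  assumes "\<And>g. g \<in> S \<Longrightarrow> c g \<noteq> 0"
  shows "stable_line (\<lambda>g. mat (c g) ** \<rho> g) S v \<longleftrightarrow> stable_line \<rho> S v"
proof -
  have "(\<exists>a. (mat (c g) ** \<rho> g) *v v = a *s v) \<longleftrightarrow> (\<exists>a. \<rho> g *v v = a *s v)" if "g \<in> S" for g
  proof
    assume "\<exists>a. (mat (c g) ** \<rho> g) *v v = a *s v"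
    then obtain a where a: "c g *s (\<rho> g *v v) = a *s v" by (auto simp: mat_mult_vec)
    have "\<rho> g *v v = (1 / c g) *s (c g *s (\<rho> g *v v))" using assms[OF that] by simp
    also have "\<dots> = (a / c g) *s v" by (simp add: a)
    finally show "\<exists>a. \<rho> g *v v = a *s v" ..
  qed (auto simp: mat_mult_vec)
  then show ?thesis by (simp add: stable_line_def)
qed

lemma semisimple_scalar_twist:
  fixes \<rho> :: "'g \<Rightarrow> 'k::field ^ 2 ^ 2"
  assumes "\<And>g. g \<in> carrier G \<Longrightarrow> c g \<noteq> 0"
  shows "semisimple_rep G (\<lambda>g. mat (c g) ** \<rho> g) \<longleftrightarrow> semisimple_rep G \<rho>"
proof -
  have "c g *s x \<in> W \<longleftrightarrow> x \<in> W" if "g \<in> carrier G" "vec.subspace W" for g x and W :: "('k ^ 2) set"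
  proof
    assume "c g *s x \<in> W"
    then have "(1 / c g) *s (c g *s x) \<in> W" using that(2) vec.subspace_scale by blast
    then show "x \<in> W" using assms[OF that(1)] by simp
  qed (use that(2) vec.subspace_scale in blast)
  then have "invariant_subspace G (\<lambda>g. mat (c g) ** \<rho> g) W \<longleftrightarrow> invariant_subspace G \<rho> W" for W
    unfolding invariant_subspace_def mat_mult_vec by blast
  then show ?thesis by (simp add: semisimple_rep_def)
qed

lemma strongly_irreducible_scalar_twist:
  assumes "\<And>g. g \<in> carrier G \<Longrightarrow> c g \<noteq> 0"
  shows "strongly_irreducible G (\<lambda>g. mat (c g) ** \<rho> g) \<longleftrightarrow> strongly_irreducible G \<rho>"
proof -
  have "stable_line (\<lambda>g. mat (c g) ** \<rho> g) H v \<longleftrightarrow> stable_line \<rho> H v" if "subgroup H G" for H v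
    using assms subgroup.mem_carrier[OF that] by (intro stable_line_scalar_twist) simp
  then show ?thesis
    using not_strongly_irreducible_iff[of G "\<lambda>g. mat (c g) ** \<rho> g"] not_strongly_irreducible_iff[of G \<rho>]
    by blast
qed

lemma (in two_dim_rep) scalar_twist_rep:
  assumes "\<And>g. g \<in> carrier G \<Longrightarrow> c g \<noteq> 0"
    and "\<And>g h. g \<in> carrier G \<Longrightarrow> h \<in> carrier G \<Longrightarrow> c (g \<otimes> h) = c g * c h"
  shows "two_dim_rep G (\<lambda>g. mat (c g) ** \<rho> g)"
proof
  have "mat (a * b) ** (M ** N) = (mat a ** M) ** (mat b ** N)" for a b and M N :: "'k ^ 2 ^ 2"
    by (simp add: mat2_simps algebra_simps)
  then show "(\<lambda>g. mat (c g) ** \<rho> g) \<in> hom G GL"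
    using assms rep_det_nonzero
    by (auto simp: hom_def GL_def invertible_det_nz det_mat_mult rep_mult)
qed

text \<open>
  For reducibility this is clear for stable lines rather than for sums of characters, which is why it goes through
  \<open>reducible_rep_iff\<close>; for dihedrality the scalars cancel from the two equations on the character.
\<close>

lemma (in two_dim_rep) reducible_dihedral_scalar_twist:
  assumes two: "(2 :: 'k) \<noteq> 0" and c: "\<And>g. g \<in> carrier G \<Longrightarrow> c g \<noteq> 0"
    and mult: "\<And>g h. g \<in> carrier G \<Longrightarrow> h \<in> carrier G \<Longrightarrow> c (g \<otimes> h) = c g * c h"
  shows "reducible_rep G (\<lambda>g. mat (c g) ** \<rho> g) \<longleftrightarrow> reducible_rep G \<rho>"
    and "dihedral_rep G (\<lambda>g. mat (c g) ** \<rho> g) \<longleftrightarrow> dihedral_rep G \<rho>"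
proof -
  interpret tw: two_dim_rep G "\<lambda>g. mat (c g) ** \<rho> g" by (rule scalar_twist_rep[OF c mult])
  show red: "reducible_rep G (\<lambda>g. mat (c g) ** \<rho> g) \<longleftrightarrow> reducible_rep G \<rho>"
    unfolding reducible_rep_iff[OF two] tw.reducible_rep_iff[OF two]
    using stable_line_scalar_twist[of "carrier G" c \<rho>] c by blast
  have "\<eta> g * (c g * trace (\<rho> g)) = c g * trace (\<rho> g) \<and> (\<eta> g)\<^sup>2 * ((c g)\<^sup>2 * det (\<rho> g)) = (c g)\<^sup>2 * det (\<rho> g)
      \<longleftrightarrow> \<eta> g * trace (\<rho> g) = trace (\<rho> g) \<and> (\<eta> g)\<^sup>2 * det (\<rho> g) = det (\<rho> g)"
    if "g \<in> carrier G" for \<eta> :: "'g \<Rightarrow> 'k" and g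
    using c[OF that] by auto
  then show "dihedral_rep G (\<lambda>g. mat (c g) ** \<rho> g) \<longleftrightarrow> dihedral_rep G \<rho>"
    using red unfolding dihedral_rep_def pseudo_dihedral_def reducible_rep_def trace_mat_mult det_mat_mult
    by (simp cong: ball_cong)
qed

lemma to_Kbar_add: "to_Kbar (a + b) = to_Kbar a + to_Kbar b"
  and to_Kbar_mult: "to_Kbar (a * b) = to_Kbar a * to_Kbar b"
  and to_Kbar_1: "to_Kbar 1 = 1"
  by (simp_all add: to_Kbar_def flip: to_ac_add to_ac_mult One_fract_def)

lemma inj_to_Kbar: "inj to_Kbar"
  by (auto simp: inj_def to_Kbar_def eq_fract)

lemma to_Kbar_unit: "a dvd 1 \<Longrightarrow> to_Kbar a \<noteq> 0"
  using to_Kbar_mult[of a] to_Kbar_1 by (metis dvdE mult_zero_left zero_neq_one)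

section \<open>The three characterisations of smallness\<close>

lemma finite_matrices:
  assumes "finite (UNIV :: 'k set)"
  shows "finite (UNIV :: ('k ^ 2 ^ 2) set)"
proof -
  have "inj (\<lambda>M :: 'k ^ 2 ^ 2. (M$1$1, M$1$2, M$2$1, M$2$2))"
    by (auto simp: inj_def vec_eq_iff forall_2)
  moreover have "finite (UNIV :: ('k \<times> 'k \<times> 'k \<times> 'k) set)"
    using assms by (simp add: finite_prod)
  then have "finite (range (\<lambda>M :: 'k ^ 2 ^ 2. (M$1$1, M$1$2, M$2$1, M$2$2)))"
    by (rule finite_subset[rotated]) simp
  ultimately show ?thesis by (rule finite_imageD[rotated])
qed

theorem proposition2p4:
  fixes p :: nat
    and G :: "('g, 'e) monoid_scheme"
    and T :: "'g topology"
    and t d :: "'g \<Rightarrow> 'a::{local_ring, idom, topological_ab_group_add, topological_comm_monoid_mult}"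
    and \<rho> :: "'g \<Rightarrow> 'a fract alg_closure ^ 2 ^ 2"
    and \<rho>0 :: "'g \<Rightarrow> 'a residue_field ^ 2 ^ 2"
  assumes "Factorial_Ring.prime p" and "odd p"
    and "profinite_group G T" and "p_finite p G T"
    and "local_pro_p_ring TYPE('a) p"
    and "pseudorep G t d"
    and "continuous_map T euclidean t" and "continuous_map T euclidean d"
    and "semisimple_carrier G \<rho>0 (residue \<circ> t) (residue \<circ> d)"
    and "semisimple_carrier G \<rho> (to_Kbar \<circ> t) (to_Kbar \<circ> d)"
  shows "(a_priori_small G t d \<rho>0 \<longleftrightarrow>
            reducible_rep G \<rho> \<or> dihedral_rep G \<rho> \<or> finite (twist_rep d \<rho> ` carrier G)) \<and>
         (reducible_rep G \<rho> \<or> dihedral_rep G \<rho> \<or> finite (twist_rep d \<rho> ` carrier G) \<longleftrightarrow>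
            \<not> strongly_irreducible G \<rho>)"
proof -
  interpret group G using assms(3) by (simp add: profinite_group_def topological_group_def)
  interpret \<rho>: two_dim_rep G \<rho>
    using assms(10) by unfold_locales (simp add: semisimple_carrier_def)
  interpret \<rho>0: two_dim_rep G \<rho>0
    using assms(9) by unfold_locales (simp add: semisimple_carrier_def)
  have tr: "trace (\<rho> g) = to_Kbar (t g)" "det (\<rho> g) = to_Kbar (d g)"
    and tr0: "trace (\<rho>0 g) = residue (t g)" "det (\<rho>0 g) = residue (d g)" if "g \<in> carrier G" for g
    using assms(9,10) that by (auto simp: semisimple_carrier_def carries_def)
  obtain I and h :: "'a \<Rightarrow> 'a set \<Rightarrow> nat" where "pro_p_presentation p I h"
    using local_pro_p_ring_presentation[OF assms(5)] by blast
  then interpret pro_p_presentation p I h .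
  have fin: "finite (UNIV :: 'a residue_field set)" using assms(5) by (simp add: local_pro_p_ring_def)
  note A = \<open>odd p\<close> fin
  have two: "(2 :: 'a fract alg_closure) \<noteq> 0"
    using to_Kbar_unit[OF two_unit[OF A]] by (metis one_add_one to_Kbar_1 to_Kbar_add)
  have d: "d g dvd 1" if "g \<in> carrier G" for g
    using assms(6) that by (simp add: pseudorep_def hom_unit_group_iff)
  have d_mult: "d (g \<otimes>\<^bsub>G\<^esub> h) = d g * d h" if "g \<in> carrier G" "h \<in> carrier G" for g h
    using assms(6) that by (simp add: pseudorep_def hom_unit_group_iff)
  define s where "s g = inv_sqrt (one_unit_part d g)" for g
  define c where "c g = to_Kbar (s g)" for g
  define \<sigma> where "\<sigma> g = mat (c g) ** \<rho> g" for g
  have \<sigma>_eq: "\<sigma> = (\<lambda>g. mat (c g) ** \<rho> g)" and twist: "twist_rep d \<rho> = \<sigma>"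
    by (simp_all add: fun_eq_iff \<sigma>_def c_def s_def twist_rep_def)
  have s: "residue (s g) = 1" "s g dvd 1" "(s g)\<^sup>2 * d g = twist_d d g"
    "twist_d d g = teichmuller (residue (d g))" if "g \<in> carrier G" for g
    using twist_scalar[OF A, of d g, OF d[OF that]] by (simp_all add: s_def)
  have c0: "c g \<noteq> 0" if "g \<in> carrier G" for g
    unfolding c_def by (rule to_Kbar_unit) (rule s(2)[OF that])
  have c_mult: "c (g \<otimes>\<^bsub>G\<^esub> h) = c g * c h" if gh: "g \<in> carrier G" "h \<in> carrier G" for g h
  proof -
    have "one_unit_part d (g \<otimes>\<^bsub>G\<^esub> h) = one_unit_part d g * one_unit_part d h"
      using gh d d_mult by (intro one_unit_part_mult[OF A]) auto
    then show ?thesis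
      using inv_sqrt_mult[OF A one_unit_part(2)[OF A, of d g] one_unit_part(2)[OF A, of d h]] d gh
      by (simp add: c_def s_def to_Kbar_mult)
  qed
  interpret \<sigma>: two_dim_rep G \<sigma>
    unfolding \<sigma>_eq by (rule \<rho>.scalar_twist_rep[OF c0 c_mult])
  have red: "reducible_rep G \<sigma> \<longleftrightarrow> reducible_rep G \<rho>" and dih: "dihedral_rep G \<sigma> \<longleftrightarrow> dihedral_rep G \<rho>"
    unfolding \<sigma>_eq using \<rho>.reducible_dihedral_scalar_twist[OF two c0 c_mult] by auto
  have strong: "strongly_irreducible G \<sigma> \<longleftrightarrow> strongly_irreducible G \<rho>"
    unfolding \<sigma>_eq by (rule strongly_irreducible_scalar_twist[OF c0])
  have tr\<sigma>: "trace (\<sigma> g) = to_Kbar (twist_t t d g)" "det (\<sigma> g) = to_Kbar (twist_d d g)"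
    if "g \<in> carrier G" for g
    using s(3)[OF that] tr[OF that]
    by (simp_all add: \<sigma>_def trace_mat_mult det_mat_mult c_def s_def twist_t_def power2_eq_square
        flip: to_Kbar_mult)
  have res_t: "residue (twist_t t d g) = residue (t g)" if "g \<in> carrier G" for g
    using s(1)[OF that] by (simp add: twist_t_def s_def residue_mult)

  have "(\<lambda>g. det (\<sigma> g)) ` carrier G \<subseteq> range (\<lambda>x. to_Kbar (teichmuller x))"
    using s(4) tr\<sigma>(2) by auto
  then have "finite ((\<lambda>g. det (\<sigma> g)) ` carrier G)" using fin by (metis finite_imageI finite_subset)
  from not_strongly_irreducible_iff_reducible_dihedral_finite[OF \<sigma>.two_dim_rep_axioms two this]
  have strong_iff: "\<not> strongly_irreducible G \<rho> \<longleftrightarrow>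
      reducible_rep G \<rho> \<or> dihedral_rep G \<rho> \<or> finite (\<sigma> ` carrier G)"
    by (simp add: red dih strong)

  have "semisimple_rep G \<sigma>"
    using semisimple_scalar_twist[of G c \<rho>, OF c0] assms(10)
    by (simp add: \<sigma>_eq semisimple_carrier_def)
  then have "kernel G GL \<sigma> = pseudo_kernel G (\<lambda>g. trace (\<sigma> g)) (\<lambda>g. det (\<sigma> g))"
    by (rule \<sigma>.semisimple_kernel)
  also have "\<dots> = pseudo_kernel G (\<lambda>g. to_Kbar (twist_t t d g)) (\<lambda>g. to_Kbar (twist_d d g))"
    by (rule pseudo_kernel_cong[OF is_group]) (simp_all add: tr\<sigma>)
  also have "\<dots> = pseudo_kernel G (twist_t t d) (twist_d d)"
    by (rule pseudo_kernel_inj[OF inj_to_Kbar to_Kbar_1])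
  finally have ker\<sigma>: "kernel G GL \<sigma> = pseudo_kernel G (twist_t t d) (twist_d d)" .
  have "semisimple_rep G \<rho>0" using assms(9) by (simp add: semisimple_carrier_def)
  then have "kernel G GL \<rho>0 = pseudo_kernel G (\<lambda>g. trace (\<rho>0 g)) (\<lambda>g. det (\<rho>0 g))"
    by (rule \<rho>0.semisimple_kernel)
  also have "\<dots> = pseudo_kernel G (\<lambda>g. residue (t g)) (\<lambda>g. residue (d g))"
    by (rule pseudo_kernel_cong[OF is_group]) (simp_all add: tr0)
  finally have ker0: "kernel G GL \<rho>0 = pseudo_kernel G (\<lambda>g. residue (t g)) (\<lambda>g. residue (d g))" .

  have sub: "kernel G GL \<sigma> \<subseteq> kernel G GL \<rho>0"
  proof
    fix g assume "g \<in> kernel G GL \<sigma>"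
    then have g: "g \<in> carrier G" "twist_d d g = 1"
      and t: "\<And>x. x \<in> carrier G \<Longrightarrow> twist_t t d (g \<otimes>\<^bsub>G\<^esub> x) = twist_t t d x"
      unfolding ker\<sigma> by (auto simp: pseudo_kernel_def)
    have "residue (d g) = residue (twist_d d g)" using s(4)[OF g(1)] teichmuller(1)[OF A] by simp
    then have "residue (d g) = 1" using g(2) by (simp add: residue_1)
    moreover have "residue (t (g \<otimes>\<^bsub>G\<^esub> x)) = residue (t x)" if "x \<in> carrier G" for x
      using t[OF that] res_t[of x] res_t[of "g \<otimes>\<^bsub>G\<^esub> x"] g(1) that by simp
    ultimately show "g \<in> kernel G GL \<rho>0" unfolding ker0 using g(1) by (simp add: pseudo_kernel_def)
  qed

  have finite_iff: "finite (\<sigma> ` carrier G) \<longleftrightarrow> kernel G GL \<sigma> = kernel G GL \<rho>0"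
    if irr: "\<not> reducible_rep G \<rho>" "\<not> dihedral_rep G \<rho>"
  proof
    assume eq: "kernel G GL \<sigma> = kernel G GL \<rho>0"
    show "finite (\<sigma> ` carrier G)"
    proof (rule finite_image_factor)
      show "finite (\<rho>0 ` carrier G)"
        using finite_matrices[OF fin] by (rule finite_subset[rotated]) simp
      fix a b assume ab: "a \<in> carrier G" "b \<in> carrier G" "\<rho>0 a = \<rho>0 b"
      have "a \<otimes>\<^bsub>G\<^esub> inv\<^bsub>G\<^esub> b \<in> kernel G GL \<rho>0"
        using ab by (simp add: kernel_def GL_def \<rho>0.rep_mult \<rho>0.rep_inv_right)
      then have trivial: "\<sigma> (a \<otimes>\<^bsub>G\<^esub> inv\<^bsub>G\<^esub> b) = mat 1"
        unfolding eq[symmetric] by (simp add: kernel_def GL_def)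
      have "\<sigma> a = \<sigma> ((a \<otimes>\<^bsub>G\<^esub> inv\<^bsub>G\<^esub> b) \<otimes>\<^bsub>G\<^esub> b)" using ab by (simp add: m_assoc)
      also have "\<dots> = \<sigma> (a \<otimes>\<^bsub>G\<^esub> inv\<^bsub>G\<^esub> b) ** \<sigma> b" using ab by (intro \<sigma>.rep_mult) auto
      finally show "\<sigma> a = \<sigma> b" by (simp add: trivial)
    qed
  next
    assume finite: "finite (\<sigma> ` carrier G)"
    define N where "N = kernel G GL \<rho>0"
    have N: "N \<lhd> G" unfolding N_def by (rule group_hom.normal_kernel[OF \<rho>0.rep_group_hom])
    have NG: "g \<in> carrier G" "\<rho>0 g = mat 1" if "g \<in> N" for g
      using that by (auto simp: N_def kernel_def GL_def)
    have det1: "det (\<sigma> g) = 1" if "g \<in> N" for g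
    proof -
      have "residue (d g) = 1" using tr0(2)[OF NG(1)[OF that]] NG(2)[OF that] by simp
      then show ?thesis using tr\<sigma>(2)[OF NG(1)[OF that]] s(4)[OF NG(1)[OF that]] teichmuller_1[OF A]
        by (simp add: to_Kbar_1)
    qed
    have "\<sigma> g = mat 1" if g: "g \<in> N" for g
    proof (rule normal_p_subgroup_trivial[OF \<sigma>.two_dim_rep_axioms two assms(1,2) N _ det1 _ _ _ g])
      show "finite (\<sigma> ` N)" using finite NG(1) by (rule_tac finite_subset[of _ "\<sigma> ` carrier G"]) auto
      show "\<not> reducible_rep G \<sigma>" "\<not> dihedral_rep G \<sigma>" using irr red dih by auto
      fix x n assume x: "x \<in> N" and n: "coprime n p" and pow: "\<sigma> (x [^]\<^bsub>G\<^esub> (n :: nat)) = mat 1"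
      have "residue (t x) = 2"
        using tr0(1)[OF NG(1)[OF x]] NG(2)[OF x] by (simp add: trace_I)
      moreover have "residue (2 :: 'a) = 2" by (metis one_add_one residue_1 residue_add)
      ultimately have "residue (twist_t t d x - 2) = 0"
        using res_t[OF NG(1)[OF x]] by (simp add: residue_diff)
      then have e: "\<not> (twist_t t d x - 2) dvd 1" by (simp add: residue_eq_0_iff)
      have "trace (\<sigma> x) = to_Kbar (2 + (twist_t t d x - 2))" using tr\<sigma>(1)[OF NG(1)[OF x]] by simp
      then show "\<sigma> x = mat 1"
        by (rule \<sigma>.one_if_power_one[OF to_Kbar_add to_Kbar_mult to_Kbar_1 NG(1)[OF x] det1[OF x]
              _ e of_nat_unit[OF n] pow])
    qed
    then have "N \<subseteq> kernel G GL \<sigma>" using NG(1) by (auto simp: kernel_def GL_def)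
    with sub show "kernel G GL \<sigma> = kernel G GL \<rho>0" by (auto simp: N_def)
  qed

  have "pseudo_reducible G (to_Kbar \<circ> t) \<longleftrightarrow> reducible_rep G \<rho>"
    unfolding reducible_rep_def by (rule pseudo_reducible_cong) (simp add: tr)
  moreover have "pseudo_dihedral G (to_Kbar \<circ> t) (to_Kbar \<circ> d) \<longleftrightarrow> dihedral_rep G \<rho>"
    unfolding dihedral_rep_def by (rule pseudo_dihedral_cong) (simp_all add: tr)
  ultimately have "a_priori_small G t d \<rho>0 \<longleftrightarrow>
      reducible_rep G \<rho> \<or> dihedral_rep G \<rho> \<or> finite (\<sigma> ` carrier G)"
    unfolding a_priori_small_def using finite_iff ker\<sigma> by blast
  with strong_iff show ?thesis unfolding twist by blast
qed

end
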